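(* Let $B_1,B_2\subset\Lambda$ be noise-type Boolean algebras. If $\mathrm{Cl}(B_1)=\mathrm{Cl}(B_2)$, then $H^{(1)}(B_1)=H^{(1)}(B_2)$.
   Context: Let $(\Omega,\mathcal F,P)$ be a probability space with $H=L_2(\Omega,\mathcal F,P)$ (real-valued functions) separable. Every $\sigma$-field is assumed to contain all null sets. $\Lambda$ is the set of all sub-$\sigma$-fields of $\mathcal F$, partially ordered by inclusion; it is a complete lattice with $x\wedge y=x\cap y$, $x\vee y=\sigma(x,y)$ (the least $\sigma$-field containing $x$ and $y$), $\inf X=\bigcap_{x\in X}x$, $\sup X=\sigma(\bigcup_{x\in X}x)$ for $X\subset\Lambda$; its greatest element is $1_\Lambda=\mathcal F$ and its least element $0_\Lambda$ is the trivial $\sigma$-field (null sets and their complements). For arbitrary $x_1,x_2,\ldots\in\Lambda$, $\liminf_n x_n=\sup_n\inf_k x_{n+k}$. A noise-type Boolean algebra is a subset $B\subset\Lambda$ that is a sublattice (closed under $\wedge,\vee$), is distributive ($x\wedge(y\vee z)=(x\wedge y)\vee(x\wedge z)$ for $x,y,z\in B$), contains $0_\Lambda$ and $1_\Lambda$, is such that every $x\in B$ has a (necessarily unique) complement $x'\in B$ ($x\wedge x'=0_\Lambda$, $x\vee x'=1_\Lambda$), and such that for every $x\in B$ the $\sigma$-fields $x$ and $x'$ are independent. Its closure is $\mathrm{Cl}(B)=\{\liminf_n x_n : x_1,x_2,\ldots\in B\}$. The first chaos space $H^{(1)}(B)$ is the closed linear subspace of $H$ consisting of all $f\in H$ such that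 $f=\mathbb E(f\mid x)+\mathbb E(f\mid x')$ for all $x\in B$, where $x'$ is the complement of $x$ in $B$. *)

theory Defs
  imports "HOL-Probability.Probability"
begin

text \<open>
  A sub-$\sigma$-field of the $\sigma$-field of \<open>M\<close> is a family of measurable sets, and it is
  required to contain all null sets. Null sets are taken among the measurable sets of \<open>M\<close>, so \<open>M\<close>
  may, but need not, be complete.
\<close>

definition sub_sigma_fields :: "'a measure \<Rightarrow> 'a set set set" where
  "sub_sigma_fields M = {x. sigma_algebra (space M) x \<and> x \<subseteq> sets M \<and> null_sets M \<subseteq> x}"

definition sf_generated :: "'a measure \<Rightarrow> 'a set set \<Rightarrow> 'a set set" where
  "sf_generated M A = sigma_sets (space M) (A \<union> null_sets M)"

definition sf_sup :: "'a measure \<Rightarrow> 'a set set \<Rightarrow> 'a set set \<Rightarrow> 'a set set" where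
  "sf_sup M x y = sf_generated M (x \<union> y)"

definition sf_Sup :: "'a measure \<Rightarrow> 'a set set set \<Rightarrow> 'a set set" where
  "sf_Sup M X = sf_generated M (\<Union>X)"

text \<open>The intersection with \<^term>\<open>sets M\<close> matters only for the empty family.\<close>

definition sf_Inf :: "'a measure \<Rightarrow> 'a set set set \<Rightarrow> 'a set set" where
  "sf_Inf M X = sets M \<inter> \<Inter>X"

definition sf_bot :: "'a measure \<Rightarrow> 'a set set" where
  "sf_bot M = null_sets M \<union> (\<lambda>N. space M - N) ` null_sets M"

definition sf_liminf :: "'a measure \<Rightarrow> (nat \<Rightarrow> 'a set set) \<Rightarrow> 'a set set" where
  "sf_liminf M x = sf_Sup M (range (\<lambda>n. sf_Inf M (range (\<lambda>k. x (n + k)))))"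

definition is_complement :: "'a measure \<Rightarrow> 'a set set \<Rightarrow> 'a set set \<Rightarrow> bool" where
  "is_complement M x y \<longleftrightarrow> x \<inter> y = sf_bot M \<and> sf_sup M x y = sets M"

definition complement_in :: "'a measure \<Rightarrow> 'a set set set \<Rightarrow> 'a set set \<Rightarrow> 'a set set" where
  "complement_in M B x = (THE y. y \<in> B \<and> is_complement M x y)"

definition noise_type_boolean_algebra :: "'a measure \<Rightarrow> 'a set set set \<Rightarrow> bool" where
  "noise_type_boolean_algebra M B \<longleftrightarrow>
     B \<subseteq> sub_sigma_fields M \<and>
     (\<forall>x\<in>B. \<forall>y\<in>B. x \<inter> y \<in> B \<and> sf_sup M x y \<in> B) \<and>
     (\<forall>x\<in>B. \<forall>y\<in>B. \<forall>z\<in>B. x \<inter> sf_sup M y z = sf_sup M (x \<inter> y) (x \<inter> z)) \<and>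
     sf_bot M \<in> B \<and> sets M \<in> B \<and>
     (\<forall>x\<in>B. \<exists>y\<in>B. is_complement M x y) \<and>
     (\<forall>x\<in>B. prob_space.indep_set M x (complement_in M B x))"

definition sf_closure :: "'a measure \<Rightarrow> 'a set set set \<Rightarrow> 'a set set set" where
  "sf_closure M B = {sf_liminf M x | x. \<forall>n. x n \<in> B}"

text \<open>
  The space $L_2$ is represented by the square-integrable functions themselves rather than by their
  classes modulo almost everywhere equality. The subsets of it defined below are closed under almost
  everywhere equality, so that they are equal iff the corresponding sets of classes are.
\<close>

definition L2_functions :: "'a measure \<Rightarrow> ('a \<Rightarrow> real) set" where
  "L2_functions M = {f \<in> borel_measurable M. integrable M (\<lambda>\<omega>. (f \<omega>)\<^sup>2)}"

definition separable_L2 :: "'a measure \<Rightarrow> bool" where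
  "separable_L2 M \<longleftrightarrow>
     (\<exists>D \<subseteq> L2_functions M. countable D \<and>
        (\<forall>f \<in> L2_functions M. \<forall>\<epsilon>>0. \<exists>d\<in>D. sqrt (\<integral>\<omega>. (f \<omega> - d \<omega>)\<^sup>2 \<partial>M) < \<epsilon>))"

definition cond_expectation :: "'a measure \<Rightarrow> ('a \<Rightarrow> real) \<Rightarrow> 'a set set \<Rightarrow> 'a \<Rightarrow> real" where
  "cond_expectation M f x = real_cond_exp M (sigma (space M) x) f"

definition first_chaos :: "'a measure \<Rightarrow> 'a set set set \<Rightarrow> ('a \<Rightarrow> real) set" where
  "first_chaos M B =
     {f \<in> L2_functions M. \<forall>x\<in>B. AE \<omega> in M.
        f \<omega> = cond_expectation M f x \<omega> + cond_expectation M f (complement_in M B x) \<omega>}"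

text \<open>The definite description in \<^const>\<open>complement_in\<close> is justified by distributivity.\<close>

lemma sf_sup_bot:
  assumes "x \<in> sub_sigma_fields M"
  shows "sf_sup M (sf_bot M) x = x"
proof -
  interpret sigma_algebra "space M" x
    using assms by (simp add: sub_sigma_fields_def)
  have "null_sets M \<subseteq> x"
    using assms by (simp add: sub_sigma_fields_def)
  then have "sf_bot M \<union> x \<union> null_sets M = x"
    unfolding sf_bot_def by blast
  then show ?thesis
    by (simp add: sf_sup_def sf_generated_def sigma_sets_eq)
qed

lemma complement_in_unique:
  assumes B: "noise_type_boolean_algebra M B" and mem: "x \<in> B" "y \<in> B" "z \<in> B"
    and y: "is_complement M x y" and z: "is_complement M x z"
  shows "y = z"
proof -
  have BL: "B \<subseteq> sub_sigma_fields M"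
    and BI: "\<And>a b. a \<in> B \<Longrightarrow> b \<in> B \<Longrightarrow> a \<inter> b \<in> B"
    and BD: "\<And>a b c. a \<in> B \<Longrightarrow> b \<in> B \<Longrightarrow> c \<in> B \<Longrightarrow>
               a \<inter> sf_sup M b c = sf_sup M (a \<inter> b) (a \<inter> c)"
    using B by (simp_all add: noise_type_boolean_algebra_def)
  have le: "u \<subseteq> v"
    if uv: "u \<in> B" "v \<in> B" and u: "is_complement M x u" and v: "is_complement M x v" for u v
  proof -
    have sub: "u \<subseteq> sets M"
      using subsetD[OF BL uv(1)] by (simp add: sub_sigma_fields_def)
    have uvB: "u \<inter> v \<in> sub_sigma_fields M"
      using subsetD[OF BL BI[OF uv]] .
    have "u = u \<inter> sf_sup M x v"
      using sub v by (simp add: is_complement_def Int_absorb2)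
    also have "\<dots> = sf_sup M (u \<inter> x) (u \<inter> v)"
      using BD[OF uv(1) mem(1) uv(2)] .
    also have "\<dots> = u \<inter> v"
      using u sf_sup_bot[OF uvB] by (simp add: is_complement_def Int_commute)
    finally show ?thesis by blast
  qed
  show ?thesis
    using le[OF mem(2,3) y z] le[OF mem(3,2) z y] by (rule subset_antisym)
qed

lemma complement_in:
  assumes "noise_type_boolean_algebra M B" and "x \<in> B"
  shows "complement_in M B x \<in> B \<and> is_complement M x (complement_in M B x)"
proof -
  obtain y where "y \<in> B" "is_complement M x y"
    using assms by (auto simp: noise_type_boolean_algebra_def)
  then have "\<exists>!y. y \<in> B \<and> is_complement M x y"
    by (intro ex1I[of _ y]) (simp, rule complement_in_unique[OF assms], simp_all)
  then show ?thesis
    unfolding complement_in_def by (rule theI')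
qed

end

theory Submission
  imports Defs
begin

text \<open>
  Write \<open>Q\<^sub>x\<close> for conditional expectation given \<open>x\<close>. It suffices to show that, for \<open>f\<close> in the first
  chaos of \<open>B\<close> and independent \<open>y\<close> and \<open>z\<close> in the closure of \<open>B\<close> that together generate everything,
  \<open>f = Q\<^sub>y f + Q\<^sub>z f\<close> (\<open>first_chaos_split_closure\<close>). Indeed, the closure of \<open>B\<^sub>1\<close> contains \<open>B\<^sub>2\<close>, so that
  \<open>y\<close> and \<open>z\<close> may be complements of each other in \<open>B\<^sub>2\<close>.

  Inside a noise-type Boolean algebra, distributivity and independence of complements give
  \<open>Q\<^sub>v Q\<^sub>u = Q\<^bsub>u \<inter> v\<^esub>\<close> (\<open>CE_CE_eq_CE_Int\<close>), and from this an inclusion-exclusion formula for the first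
  chaos (\<open>first_chaos_sf_sup\<close>):
  \<open>Q\<^bsub>u \<or> v\<^esub> f = Q\<^sub>u f + Q\<^sub>v f - Q\<^sub>v Q\<^sub>u f\<close> for \<open>u, v \<in> B\<close>.
  Now let \<open>u\<close> tend to \<open>y\<close> and \<open>v\<close> to \<open>z\<close>. On the right the limit is \<open>Q\<^sub>y f + Q\<^sub>z f - Q\<^sub>z Q\<^sub>y f\<close>, because
  conditional expectations contract the distance of \<open>L\<^sub>1\<close>; and \<open>Q\<^sub>z Q\<^sub>y f\<close> is the constant
  \<open>\<integral>f\<close>, by independence, which vanishes because \<open>f\<close> splits over the trivial and the full
  \<open>\<sigma>\<close>-field. On the left the limit is \<open>f\<close>: linear combinations of
  products \<open>1\<^sub>A 1\<^sub>C\<close> with \<open>A \<in> y\<close> and \<open>C \<in> z\<close> are dense in \<open>L\<^sub>1\<close>, and each of them is close to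
  \<open>Q\<^sub>u 1\<^sub>A \<cdot> Q\<^sub>v 1\<^sub>C\<close>, which is measurable with respect to \<open>u \<or> v\<close> (\<open>tendsto_CE_sf_sup\<close>).

  What \<open>u\<close> tends to \<open>y\<close> means is that \<open>Q\<^sub>u g\<close> tends to \<open>Q\<^sub>y g\<close> for all square-integrable \<open>g\<close>. That \<open>y\<close>
  is approximated in this sense by elements of \<open>B\<close> follows from two martingale convergence theorems,
  for increasing and for decreasing sequences of \<open>\<sigma>\<close>-fields: a lower limit is an increasing limit of
  infima, and each infimum is a decreasing limit of finite intersections, which belong to \<open>B\<close>. As the
  second limit is taken first, the approximation is along a filter on \<open>B\<close> (\<open>sf_closure_filter\<close>).
\<close>

section \<open>Distance in $L_1$\<close>

context prob_space
begin

abbreviation CE :: "'a set set \<Rightarrow> ('a \<Rightarrow> real) \<Rightarrow> 'a \<Rightarrow> real" where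
  "CE x f \<equiv> cond_expectation M f x"

text \<open>
  Limits of conditional expectations are taken in $L_1$ rather than in $L_2$: conditional expectation
  contracts this distance as well, and a product with a bounded factor is estimated in one line.
\<close>
definition dist1 :: "('a \<Rightarrow> real) \<Rightarrow> ('a \<Rightarrow> real) \<Rightarrow> real" where
  "dist1 f g = expectation (\<lambda>\<omega>. \<bar>f \<omega> - g \<omega>\<bar>)"

lemma dist1_nonneg: "0 \<le> dist1 f g"
  unfolding dist1_def by simp

lemma dist1_commute: "dist1 f g = dist1 g f"
  unfolding dist1_def by (simp add: abs_minus_commute)

lemma dist1_triangle:
  assumes "integrable M f" "integrable M g" "integrable M h"
  shows "dist1 f h \<le> dist1 f g + dist1 g h"
proof -
  have "dist1 f h \<le> expectation (\<lambda>\<omega>. \<bar>f \<omega> - g \<omega>\<bar> + \<bar>g \<omega> - h \<omega>\<bar>)"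
    unfolding dist1_def using assms by (intro integral_mono) auto
  also have "\<dots> = dist1 f g + dist1 g h"
    unfolding dist1_def using assms by (intro Bochner_Integration.integral_add) auto
  finally show ?thesis .
qed

lemma dist1_cong_AE:
  assumes "AE \<omega> in M. f \<omega> = f' \<omega>" "AE \<omega> in M. g \<omega> = g' \<omega>"
    and "integrable M f" "integrable M f'" "integrable M g" "integrable M g'"
  shows "dist1 f g = dist1 f' g'"
  unfolding dist1_def by (rule integral_cong_AE) (use assms in auto)

lemma dist1_eq_0_iff:
  assumes "integrable M f" "integrable M g"
  shows "dist1 f g = 0 \<longleftrightarrow> (AE \<omega> in M. f \<omega> = g \<omega>)"
  unfolding dist1_def using assms
  by (subst integral_nonneg_eq_0_iff_AE) auto

lemma tendsto_0_dist1I: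
  assumes "\<And>\<epsilon>. 0 < \<epsilon> \<Longrightarrow> eventually (\<lambda>i. dist1 (f i) (g i) < \<epsilon>) F"
  shows "((\<lambda>i. dist1 (f i) (g i)) \<longlongrightarrow> 0) F"
  using assms by (intro tendstoI) (simp add: dist1_nonneg)

lemma tendsto_0_dist1D:
  assumes "((\<lambda>i. dist1 (f i) (g i)) \<longlongrightarrow> 0) F" "0 < \<epsilon>"
  shows "eventually (\<lambda>i. dist1 (f i) (g i) < \<epsilon>) F"
  using order_tendstoD(2)[OF assms] .

lemma integrable_indicat: "A \<in> sets M \<Longrightarrow> integrable M (indicat_real A)"
  by (intro integrable_real_indicator) (auto simp: emeasure_eq_measure)

section \<open>The lattice of sub-$\sigma$-fields\<close>

lemma sub_sigma_field_sigma_sets: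
  assumes "x \<in> sub_sigma_fields M"
  shows "sigma_sets (space M) x = x"
  using assms by (simp add: sub_sigma_fields_def sigma_algebra.sigma_sets_eq)

lemma sub_sigma_field_sets:
  assumes "x \<in> sub_sigma_fields M"
  shows "sets (sigma (space M) x) = x"
  using assms by (simp add: sub_sigma_fields_def sigma_algebra.sets_measure_of_eq)

lemma sub_sigma_field_subset: "x \<in> sub_sigma_fields M \<Longrightarrow> x \<subseteq> sets M"
  by (simp add: sub_sigma_fields_def)

lemma sub_sigma_field_space: "x \<in> sub_sigma_fields M \<Longrightarrow> space M \<in> x"
  unfolding sub_sigma_fields_def using sigma_algebra.axioms(1) algebra.top by blast

lemma sub_sigma_field_Int:
  "x \<in> sub_sigma_fields M \<Longrightarrow> A \<in> x \<Longrightarrow> C \<in> x \<Longrightarrow> A \<inter> C \<in> x"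
  unfolding sub_sigma_fields_def
  by (metis (mono_tags, lifting) mem_Collect_eq sigma_algebra.axioms(1) algebra_iff_Int)

lemma sf_generated_in_sub_sigma_fields:
  assumes "A \<subseteq> sets M"
  shows "sf_generated M A \<in> sub_sigma_fields M"
proof -
  have *: "A \<union> null_sets M \<subseteq> sets M" using assms by auto
  then have "A \<union> null_sets M \<subseteq> Pow (space M)" using sets.space_closed by blast
  then have "sigma_algebra (space M) (sf_generated M A)"
    unfolding sf_generated_def by (rule sigma_algebra_sigma_sets)
  moreover have "sf_generated M A \<subseteq> sets M"
    unfolding sf_generated_def using * by (rule sets.sigma_sets_subset)
  ultimately show ?thesis
    by (auto simp: sub_sigma_fields_def sf_generated_def)
qed

lemma sf_sup_in_sub_sigma_fields:
  assumes "x \<in> sub_sigma_fields M" "y \<in> sub_sigma_fields M"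
  shows "sf_sup M x y \<in> sub_sigma_fields M"
  unfolding sf_sup_def using assms
  by (intro sf_generated_in_sub_sigma_fields) (auto simp: sub_sigma_fields_def)

lemma sf_sup_upper: "x \<subseteq> sf_sup M x y" "y \<subseteq> sf_sup M x y"
  unfolding sf_sup_def sf_generated_def by auto

lemma sf_sup_commute: "sf_sup M x y = sf_sup M y x"
  unfolding sf_sup_def by (simp add: Un_commute)

lemma sf_Sup_in_sub_sigma_fields:
  assumes "X \<subseteq> sub_sigma_fields M"
  shows "sf_Sup M X \<in> sub_sigma_fields M"
  unfolding sf_Sup_def using assms
  by (intro sf_generated_in_sub_sigma_fields) (auto simp: sub_sigma_fields_def)

lemma sf_Inf_in_sub_sigma_fields:
  assumes "X \<subseteq> sub_sigma_fields M"
  shows "sf_Inf M X \<in> sub_sigma_fields M"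
proof -
  have "sf_Inf M X = \<Inter>(insert (sets M) X)" by (simp add: sf_Inf_def)
  moreover have "sigma_algebra (space M) (\<Inter>(insert (sets M) X))"
    unfolding sigma_algebra_iff2
  proof (intro conjI)
    have *: "sigma_algebra (space M) x" if "x \<in> insert (sets M) X" for x
      using that assms sets.sigma_algebra_axioms by (auto simp: sub_sigma_fields_def)
    show "\<Inter>(insert (sets M) X) \<subseteq> Pow (space M)" using sets.space_closed by blast
    show "{} \<in> \<Inter>(insert (sets M) X)" using * unfolding sigma_algebra_iff2 by blast
    show "\<forall>s\<in>\<Inter>(insert (sets M) X). space M - s \<in> \<Inter>(insert (sets M) X)"
      using * unfolding sigma_algebra_iff2 by blast
    show "\<forall>A. range A \<subseteq> \<Inter>(insert (sets M) X) \<longrightarrow> (\<Union>i::nat. A i) \<in> \<Inter>(insert (sets M) X)"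
    proof (intro allI impI InterI)
      fix A :: "nat \<Rightarrow> 'a set" and x
      assume A: "range A \<subseteq> \<Inter>(insert (sets M) X)" and x: "x \<in> insert (sets M) X"
      then have "range A \<subseteq> x" by blast
      then show "(\<Union>i. A i) \<in> x" using *[OF x] unfolding sigma_algebra_iff2 by blast
    qed
  qed
  ultimately show ?thesis using assms by (auto simp: sub_sigma_fields_def)
qed

lemma sf_bot_subset:
  assumes "x \<in> sub_sigma_fields M"
  shows "sf_bot M \<subseteq> x"
proof -
  interpret sigma_algebra "space M" x using assms by (simp add: sub_sigma_fields_def)
  show ?thesis using assms by (auto simp: sf_bot_def sub_sigma_fields_def)
qed

lemma sf_sup_eq_sigma_sets_rectangles:
  assumes a: "a \<in> sub_sigma_fields M" and b: "b \<in> sub_sigma_fields M"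
  defines "G \<equiv> {A \<inter> C | A C. A \<in> a \<and> C \<in> b}"
  shows "sf_sup M a b = sigma_sets (space M) G" and "Int_stable G" and "G \<subseteq> sets M" and "space M \<in> G"
proof -
  note sp = sub_sigma_field_space[OF a] sub_sigma_field_space[OF b]
  have am: "a \<subseteq> sets M" and bm: "b \<subseteq> sets M"
    using a b sub_sigma_field_subset by auto
  show G: "G \<subseteq> sets M" unfolding G_def using am bm by blast
  show "space M \<in> G" unfolding G_def using sp by blast
  show "Int_stable G"
  proof (rule Int_stableI)
    fix X Y assume "X \<in> G" "Y \<in> G"
    then obtain A C A' C' where *: "A \<in> a" "A' \<in> a" "C \<in> b" "C' \<in> b" "X = A \<inter> C" "Y = A' \<inter> C'"
      unfolding G_def by blast
    then have "X \<inter> Y = (A \<inter> A') \<inter> (C \<inter> C')" by blast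
    moreover have "A \<inter> A' \<in> a" "C \<inter> C' \<in> b" using * sub_sigma_field_Int a b by blast+
    ultimately show "X \<inter> Y \<in> G" unfolding G_def by blast
  qed
  have "a \<subseteq> G"
  proof
    fix A assume A: "A \<in> a"
    then have "A = A \<inter> space M" using am sets.sets_into_space by blast
    then show "A \<in> G" unfolding G_def using A sp by blast
  qed
  moreover have "b \<subseteq> G"
  proof
    fix C assume C: "C \<in> b"
    then have "C = space M \<inter> C" using bm sets.sets_into_space by blast
    then show "C \<in> G" unfolding G_def using C sp by blast
  qed
  moreover have "null_sets M \<subseteq> a" using a by (simp add: sub_sigma_fields_def)
  ultimately have "a \<union> b \<union> null_sets M \<subseteq> sigma_sets (space M) G"
    by (auto intro: sigma_sets.Basic)
  then have "sf_sup M a b \<subseteq> sigma_sets (space M) G"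
    unfolding sf_sup_def sf_generated_def by (rule sigma_sets_mono)
  moreover have "G \<subseteq> sf_sup M a b"
  proof
    fix X assume "X \<in> G"
    then obtain A C where X: "A \<in> a" "C \<in> b" "X = A \<inter> C" unfolding G_def by blast
    then have "A \<in> sf_sup M a b" "C \<in> sf_sup M a b" using sf_sup_upper by blast+
    then show "X \<in> sf_sup M a b"
      using sub_sigma_field_Int[OF sf_sup_in_sub_sigma_fields[OF a b]] X by simp
  qed
  then have "sigma_sets (space M) G \<subseteq> sf_sup M a b"
    using sub_sigma_field_sigma_sets[OF sf_sup_in_sub_sigma_fields[OF a b]] 
    by (metis sigma_sets_mono')
  ultimately show "sf_sup M a b = sigma_sets (space M) G" by blast
qed

section \<open>Conditional expectation\<close>

lemma sigma_finite_subalgebra_sub_sigma_field: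
  assumes "x \<in> sub_sigma_fields M"
  shows "sigma_finite_subalgebra M (sigma (space M) x)"
proof -
  have "subalgebra M (sigma (space M) x)"
    using assms by (simp add: subalgebra_def sub_sigma_field_sets sub_sigma_field_subset space_measure_of_conv)
  then have "finite_measure_subalgebra M (sigma (space M) x)"
    by (simp add: finite_measure_axioms finite_measure_subalgebra_axioms_def finite_measure_subalgebra_def)
  then show ?thesis by (rule finite_measure_subalgebra_is_sigma_finite)
qed

lemma subalgebra_sub_sigma_fields:
  assumes "x \<in> sub_sigma_fields M" "y \<in> sub_sigma_fields M" "x \<subseteq> y"
  shows "subalgebra (sigma (space M) y) (sigma (space M) x)"
  using assms by (simp add: subalgebra_def sub_sigma_field_sets space_measure_of_conv)

lemma measurable_sub_sigma_field:
  assumes "x \<in> sub_sigma_fields M" "f \<in> borel_measurable (sigma (space M) x)"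
  shows "f \<in> borel_measurable M"
  using assms sigma_finite_subalgebra.subalg[OF sigma_finite_subalgebra_sub_sigma_field]
  by (blast intro: measurable_from_subalg)

lemma measurable_sigma_eq:
  assumes "x = sigma_sets (space M) G" "G \<subseteq> sets M" "x \<subseteq> sets M" 
    "f \<in> borel_measurable (sigma (space M) x)"
  shows "f \<in> borel_measurable (sigma (space M) G)"
proof -
  have "G \<subseteq> Pow (space M)" "x \<subseteq> Pow (space M)" using assms sets.space_closed by blast+
  then have "sets (sigma (space M) x) = sets (sigma (space M) G)"
    using assms(1) by (simp add: sigma_sets_sigma_sets_eq)
  then show ?thesis using assms(4) measurable_cong_sets by blast
qed

lemma measurable_sigma_events:
  fixes f :: "'a \<Rightarrow> real"
  assumes "integrable M f"
  shows "f \<in> borel_measurable (sigma (space M) events)"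
proof -
  have "sets (sigma (space M) events) = sets M" by simp
  then show ?thesis using borel_measurable_integrable[OF assms] measurable_cong_sets by blast
qed

lemma measurable_sf_Inf:
  fixes h :: "'a \<Rightarrow> real"
  assumes X: "X \<subseteq> sub_sigma_fields M" and h: "h \<in> borel_measurable M"
    and "\<And>x. x \<in> X \<Longrightarrow> h \<in> borel_measurable (sigma (space M) x)"
  shows "h \<in> borel_measurable (sigma (space M) (sf_Inf M X))"
proof (rule measurableI)
  fix A :: "real set" assume A: "A \<in> sets borel"
  have "h -` A \<inter> space M \<in> x" if "x \<in> X" for x
    using measurable_sets[OF assms(3)[OF that] A] sub_sigma_field_sets[of x] that X
    by (auto simp: space_measure_of_conv)
  moreover have "h -` A \<inter> space M \<in> sets M" using measurable_sets[OF h A] .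
  ultimately have "h -` A \<inter> space M \<in> sf_Inf M X" unfolding sf_Inf_def by blast
  then show "h -` A \<inter> space (sigma (space M) (sf_Inf M X)) \<in> sets (sigma (space M) (sf_Inf M X))"
    using sub_sigma_field_sets[OF sf_Inf_in_sub_sigma_fields[OF X]] by (simp add: space_measure_of_conv)
qed simp

lemma CE_measurable: "CE x f \<in> borel_measurable (sigma (space M) x)"
  unfolding cond_expectation_def by simp

lemma CE_integrable:
  assumes "x \<in> sub_sigma_fields M" "integrable M f"
  shows "integrable M (CE x f)"
  unfolding cond_expectation_def
  using sigma_finite_subalgebra.real_cond_exp_int(1)[OF sigma_finite_subalgebra_sub_sigma_field] assms
  by blast

lemma CE_measurable_id:
  assumes "x \<in> sub_sigma_fields M" "integrable M f" "f \<in> borel_measurable (sigma (space M) x)"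
  shows "AE \<omega> in M. CE x f \<omega> = f \<omega>"
  unfolding cond_expectation_def
  using sigma_finite_subalgebra.real_cond_exp_F_meas[OF sigma_finite_subalgebra_sub_sigma_field] assms
  by blast

lemma CE_cong:
  assumes "x \<in> sub_sigma_fields M" "integrable M f" "integrable M g" "AE \<omega> in M. f \<omega> = g \<omega>"
  shows "AE \<omega> in M. CE x f \<omega> = CE x g \<omega>"
  unfolding cond_expectation_def
  using sigma_finite_subalgebra.real_cond_exp_cong[OF sigma_finite_subalgebra_sub_sigma_field] assms
  by blast

lemma CE_lin:
  assumes x: "x \<in> sub_sigma_fields M" and f: "integrable M f" and g: "integrable M g"
  shows "AE \<omega> in M. CE x (\<lambda>\<omega>. a * f \<omega> + b * g \<omega>) \<omega> = a * CE x f \<omega> + b * CE x g \<omega>"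
proof -
  interpret sigma_finite_subalgebra M "sigma (space M) x"
    by (rule sigma_finite_subalgebra_sub_sigma_field[OF x])
  have "AE \<omega> in M. CE x (\<lambda>\<omega>. a * f \<omega> + b * g \<omega>) \<omega> = CE x (\<lambda>\<omega>. a * f \<omega>) \<omega> + CE x (\<lambda>\<omega>. b * g \<omega>) \<omega>"
    unfolding cond_expectation_def using f g by (intro real_cond_exp_add) auto
  moreover have "AE \<omega> in M. CE x (\<lambda>\<omega>. a * f \<omega>) \<omega> = a * CE x f \<omega>" 
    unfolding cond_expectation_def using f by (rule real_cond_exp_cmult)
  moreover have "AE \<omega> in M. CE x (\<lambda>\<omega>. b * g \<omega>) \<omega> = b * CE x g \<omega>" 
    unfolding cond_expectation_def using g by (rule real_cond_exp_cmult)
  ultimately show ?thesis by eventually_elim simp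
qed

lemma CE_diff:
  assumes x: "x \<in> sub_sigma_fields M" and f: "integrable M f" and g: "integrable M g"
  shows "AE \<omega> in M. CE x (\<lambda>\<omega>. f \<omega> - g \<omega>) \<omega> = CE x f \<omega> - CE x g \<omega>"
  using CE_lin[OF assms, of 1 "-1"] by simp

lemma CE_add:
  assumes x: "x \<in> sub_sigma_fields M" and f: "integrable M f" and g: "integrable M g"
  shows "AE \<omega> in M. CE x (\<lambda>\<omega>. f \<omega> + g \<omega>) \<omega> = CE x f \<omega> + CE x g \<omega>"
  using CE_lin[OF assms, of 1 1] by simp

lemma CE_tower:
  assumes "x \<in> sub_sigma_fields M" "y \<in> sub_sigma_fields M" "x \<subseteq> y" "integrable M f"
  shows "AE \<omega> in M. CE x (CE y f) \<omega> = CE x f \<omega>"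
  unfolding cond_expectation_def
  using sigma_finite_subalgebra.real_cond_exp_nested_subalg[OF sigma_finite_subalgebra_sub_sigma_field]
    subalgebra_sub_sigma_fields sigma_finite_subalgebra.subalg[OF sigma_finite_subalgebra_sub_sigma_field] assms
  by metis

lemma CE_measurable_mono:
  assumes "x \<in> sub_sigma_fields M" "y \<in> sub_sigma_fields M" "x \<subseteq> y"
  shows "CE x f \<in> borel_measurable (sigma (space M) y)"
  using measurable_from_subalg[OF subalgebra_sub_sigma_fields[OF assms] CE_measurable] .

lemma CE_tower_le:
  assumes "x \<in> sub_sigma_fields M" "y \<in> sub_sigma_fields M" "x \<subseteq> y" "integrable M f"
  shows "AE \<omega> in M. CE y (CE x f) \<omega> = CE x f \<omega>"
  using assms by (intro CE_measurable_id CE_integrable CE_measurable_mono)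

lemma CE_contraction:
  assumes x: "x \<in> sub_sigma_fields M" and f: "integrable M f" and g: "integrable M g"
  shows "dist1 (CE x f) (CE x g) \<le> dist1 f g"
proof -
  interpret sigma_finite_subalgebra M "sigma (space M) x"
    by (rule sigma_finite_subalgebra_sub_sigma_field[OF x])
  define h where "h \<omega> = f \<omega> - g \<omega>" for \<omega>
  have h: "integrable M h" unfolding h_def using f g by simp
  have "AE \<omega> in M. CE x h \<omega> \<le> CE x (\<lambda>\<omega>. \<bar>h \<omega>\<bar>) \<omega>"
    unfolding cond_expectation_def using h by (intro real_cond_exp_mono) auto
  moreover have "AE \<omega> in M. CE x (\<lambda>\<omega>. - \<bar>h \<omega>\<bar>) \<omega> \<le> CE x h \<omega>"
    unfolding cond_expectation_def using h by (intro real_cond_exp_mono) auto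
  moreover have "AE \<omega> in M. CE x (\<lambda>\<omega>. - \<bar>h \<omega>\<bar>) \<omega> = - CE x (\<lambda>\<omega>. \<bar>h \<omega>\<bar>) \<omega>"
    unfolding cond_expectation_def using real_cond_exp_cmult[of "\<lambda>\<omega>. \<bar>h \<omega>\<bar>" "-1"] h by simp
  moreover have "AE \<omega> in M. CE x h \<omega> = CE x f \<omega> - CE x g \<omega>"
    unfolding h_def by (rule CE_diff[OF x f g])
  ultimately have *: "AE \<omega> in M. \<bar>CE x f \<omega> - CE x g \<omega>\<bar> \<le> CE x (\<lambda>\<omega>. \<bar>h \<omega>\<bar>) \<omega>"
    by eventually_elim linarith
  have "dist1 (CE x f) (CE x g) \<le> expectation (CE x (\<lambda>\<omega>. \<bar>h \<omega>\<bar>))"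
    unfolding dist1_def using x f g h * by (intro integral_mono_AE) (auto intro!: CE_integrable)
  also have "\<dots> = expectation (\<lambda>\<omega>. \<bar>h \<omega>\<bar>)"
    unfolding cond_expectation_def using h by (intro real_cond_exp_int) auto
  finally show ?thesis unfolding h_def dist1_def .
qed

text \<open>
  Conditional expectation in $L_1$ is within a factor of two of the best approximation.
\<close>
lemma dist1_CE_le_twice:
  assumes w: "w \<in> sub_sigma_fields M" and f: "integrable M f"
    and k: "integrable M k" "k \<in> borel_measurable (sigma (space M) w)"
  shows "dist1 (CE w f) f \<le> 2 * dist1 k f"
proof -
  have "dist1 (CE w f) f \<le> dist1 (CE w f) k + dist1 k f"
    using f k CE_integrable[OF w] by (intro dist1_triangle)
  also have "dist1 (CE w f) k = dist1 (CE w f) (CE w k)"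
    using AE_symmetric[OF CE_measurable_id[OF w k]] f k CE_integrable[OF w] by (intro dist1_cong_AE) auto
  also have "\<dots> \<le> dist1 k f" using CE_contraction[OF w f k(1)] by (simp add: dist1_commute)
  finally show ?thesis by simp
qed

lemma CE_indicat_bounds:
  assumes x: "x \<in> sub_sigma_fields M" and C: "C \<in> sets M"
  shows "AE \<omega> in M. \<bar>CE x (indicat_real C) \<omega>\<bar> \<le> 1"
proof -
  interpret sigma_finite_subalgebra M "sigma (space M) x"
    by (rule sigma_finite_subalgebra_sub_sigma_field[OF x])
  have "AE \<omega> in M. CE x (indicat_real C) \<omega> \<le> 1" "AE \<omega> in M. CE x (indicat_real C) \<omega> \<ge> 0"
    unfolding cond_expectation_def using integrable_indicat[OF C]
    by (auto intro!: real_cond_exp_le_c real_cond_exp_ge_c simp: indicator_def)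
  then show ?thesis by eventually_elim simp
qed

section \<open>Density in $L_1$ and independence\<close>

text \<open>
  A linear property that is preserved by limits in $L_1$ passes from the indicators of a generator
  stable under intersection to all integrable functions measurable with respect to the generated
  $\sigma$-field. The sets whose indicators have the property form a Dynkin system, and simple
  functions are dense.
\<close>
lemma integrable_generator_induct[consumes 5, case_names basic lin lim]:
  fixes g :: "'a \<Rightarrow> real"
  assumes G: "Int_stable G" "G \<subseteq> sets M" "space M \<in> G"
    and g: "integrable M g" "g \<in> borel_measurable (sigma (space M) G)"
    and basic: "\<And>A. A \<in> G \<Longrightarrow> P (indicat_real A)"
    and lin: "\<And>a b f h. integrable M f \<Longrightarrow> integrable M h \<Longrightarrow> P f \<Longrightarrow> P h \<Longrightarrow> P (\<lambda>\<omega>. a * f \<omega> + b * h \<omega>)"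
    and lim: "\<And>f s. integrable M f \<Longrightarrow> (\<And>n. integrable M (s n)) \<Longrightarrow> (\<And>n. P (s n)) \<Longrightarrow>
                (\<lambda>n::nat. dist1 (s n) f) \<longlonglongrightarrow> 0 \<Longrightarrow> P f"
  shows "P g"
proof -
  have GP: "G \<subseteq> Pow (space M)" using G(2) sets.space_closed by blast
  have sG: "sets (sigma (space M) G) = sigma_sets (space M) G" using GP by (rule sets_measure_of)
  have sub: "sigma_sets (space M) G \<subseteq> sets M" using G(2) by (rule sets.sigma_sets_subset)
  have int: "integrable M (indicat_real A)" if "A \<in> sigma_sets (space M) G" for A
    using that sub by (intro integrable_indicat) auto
  have zero: "P (\<lambda>_. 0)"
    using lin[OF int int basic basic, of "space M" "space M" 0 0] G(3) by (auto intro: sigma_sets.Basic)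
  have ind: "P (indicat_real A)" if "A \<in> sigma_sets (space M) G" for A
    using G(1) GP that
  proof (induction rule: sigma_sets_induct_disjoint)
    case (basic A)
    then show ?case by (rule assms(6))
  next
    case empty
    then show ?case using zero by (simp add: indicator_def)
  next
    case (compl A)
    have "A \<subseteq> space M" using compl(1) sub sets.sets_into_space by blast
    then have "indicat_real (space M - A) = (\<lambda>\<omega>. 1 * indicat_real (space M) \<omega> + (-1) * indicat_real A \<omega>)"
      by (auto simp: indicator_def fun_eq_iff)
    then show ?case
      using lin[OF int int assms(6)[OF G(3)] compl(2), of 1 "-1"] G(3) compl(1)
      by (simp add: sigma_sets.Basic)
  next
    case (union A)
    have A: "A i \<in> sigma_sets (space M) G" for i using union(2) by auto
    then have [measurable]: "A i \<in> sets M" for i using sub by auto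
    have part: "P (\<lambda>\<omega>. \<Sum>i<n. indicat_real (A i) \<omega>)" for n
    proof (induction n)
      case 0
      then show ?case using zero by simp
    next
      case (Suc n)
      then show ?case using lin[OF _ int[OF A] Suc union(3)[of n], of 1 1]
        by (simp add: Bochner_Integration.integrable_sum int[OF A])
    qed
    have lim0: "(\<lambda>n. dist1 (\<lambda>\<omega>. \<Sum>i<n. indicat_real (A i) \<omega>) (indicat_real (\<Union>i. A i))) \<longlonglongrightarrow> expectation (\<lambda>_. 0)"
      unfolding dist1_def
    proof (rule integral_dominated_convergence[where w = "\<lambda>_. 1"])
      have sums: "(\<lambda>n. indicat_real (A n) \<omega>) sums indicat_real (\<Union>i. A i) \<omega>" for \<omega>
        by (rule indicator_sums) (use union(1) in \<open>auto simp: disjoint_family_on_def\<close>)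
      then show "AE \<omega> in M. (\<lambda>n. \<bar>(\<Sum>i<n. indicat_real (A i) \<omega>) - indicat_real (\<Union>i. A i) \<omega>\<bar>) \<longlonglongrightarrow> 0"
        by (simp add: sums_def LIM_zero tendsto_rabs_zero)
      have "\<bar>(\<Sum>i<n. indicat_real (A i) \<omega>) - indicat_real (\<Union>i. A i) \<omega>\<bar> \<le> 1" for n \<omega>
      proof -
        have "(\<Sum>i<n. indicat_real (A i) \<omega>) \<le> indicat_real (\<Union>i. A i) \<omega>"
          using sum_le_suminf[of "\<lambda>n. indicat_real (A n) \<omega>" "{..<n}"] sums[of \<omega>] 
          by (simp add: sums_unique[OF sums, symmetric] sums_summable)
        moreover have "0 \<le> (\<Sum>i<n. indicat_real (A i) \<omega>)" by (simp add: sum_nonneg)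
        moreover have "indicat_real (\<Union>i. A i) \<omega> \<le> 1" by (simp add: indicator_def)
        ultimately show ?thesis by linarith
      qed
      then show "AE \<omega> in M. norm \<bar>(\<Sum>i<n. indicat_real (A i) \<omega>) - indicat_real (\<Union>i. A i) \<omega>\<bar> \<le> 1" for n
        by simp
    qed measurable
    show ?case
      by (rule lim[OF _ _ part])
        (use lim0 in \<open>auto intro!: Bochner_Integration.integrable_sum int A sigma_sets.Union\<close>)
  qed
  let ?N = "restr_to_subalg M (sigma (space M) G)"
  have subalg: "subalgebra M (sigma (space M) G)"
    using sub by (simp add: subalgebra_def sG space_measure_of_conv)
  have "integrable ?N g" using integrable_in_subalg[OF subalg g(2,1)] .
  then show ?thesis
  proof (induction rule: integrable_induct)
    case (base A c)
    have A: "A \<in> sigma_sets (space M) G" using base(1) sG sets_restr_to_subalg[OF subalg] by simp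
    then show ?case using lin[OF int int ind ind, OF A A A A, of c 0] by (simp add: mult.commute)
  next
    case (add f h)
    then have "integrable M f" "integrable M h" using integrable_from_subalg[OF subalg] by blast+
    then show ?case using lin[of f h 1 1] add by simp
  next
    case (lim f s)
    have f: "integrable M f" and s: "integrable M (s n)" for n
      using lim integrable_from_subalg[OF subalg] by blast+
    have "(\<lambda>n. dist1 (s n) f) \<longlonglongrightarrow> expectation (\<lambda>_. 0)"
      unfolding dist1_def
    proof (rule integral_dominated_convergence[where w = "\<lambda>\<omega>. 3 * \<bar>f \<omega>\<bar>"])
      have "(\<lambda>i. s i \<omega>) \<longlonglongrightarrow> f \<omega>" if "\<omega> \<in> space M" for \<omega>
        using lim.hyps that by (simp add: space_restr_to_subalg)
      then have "(\<lambda>i. \<bar>s i \<omega> - f \<omega>\<bar>) \<longlonglongrightarrow> 0" if "\<omega> \<in> space M" for \<omega>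
        using that by (intro tendsto_rabs_zero LIM_zero) auto
      then show "AE \<omega> in M. (\<lambda>i. \<bar>s i \<omega> - f \<omega>\<bar>) \<longlonglongrightarrow> 0" by simp
      have *: "\<bar>s i \<omega>\<bar> \<le> 2 * \<bar>f \<omega>\<bar>" if "\<omega> \<in> space M" for \<omega> i
        using lim.hyps that by (simp add: space_restr_to_subalg)
      then have "\<bar>s i \<omega> - f \<omega>\<bar> \<le> 3 * \<bar>f \<omega>\<bar>" if "\<omega> \<in> space M" for \<omega> i
        using *[OF that, of i] by linarith
      then show "AE \<omega> in M. norm \<bar>s i \<omega> - f \<omega>\<bar> \<le> 3 * \<bar>f \<omega>\<bar>" for i by simp
    qed (use f s in auto)
    then show ?case using assms(8)[OF f s lim.IH] by simp
  qed
qed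

text \<open>
  The two sides have the same integral over every \<open>D \<in> y\<close>, since \<open>D \<inter> A\<close> and \<open>C\<close> are independent.
\<close>
lemma CE_indep_rectangle:
  assumes y: "y \<in> sub_sigma_fields M" and ind: "indep_set y b"
    and A: "A \<in> y" and C: "C \<in> b"
  shows "AE \<omega> in M. CE y (indicat_real (A \<inter> C)) \<omega> = prob C * indicat_real A \<omega>"
proof -
  interpret sigma_finite_subalgebra M "sigma (space M) y"
    by (rule sigma_finite_subalgebra_sub_sigma_field[OF y])
  have "b \<subseteq> events" using ind by (rule indep_setD_ev2)
  then have [measurable]: "A \<in> sets M" "C \<in> sets M" 
    using A C sub_sigma_field_subset[OF y] by blast+
  show ?thesis
    unfolding cond_expectation_def
  proof (rule real_cond_exp_charact)
    fix D assume "D \<in> sets (sigma (space M) y)"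
    then have D: "D \<in> y" using sub_sigma_field_sets[OF y] by simp
    then have [measurable]: "D \<in> sets M" using sub_sigma_field_subset[OF y] by blast
    have "(\<integral>\<omega>\<in>D. indicat_real (A \<inter> C) \<omega> \<partial>M) = prob (D \<inter> A \<inter> C)"
      by (simp add: set_lebesgue_integral_def indicator_inter_arith[symmetric] Int_assoc)
    also have "\<dots> = prob (D \<inter> A) * prob C"
      using indep_setD[OF ind sub_sigma_field_Int[OF y D A] C] .
    also have "\<dots> = (\<integral>\<omega>\<in>D. prob C * indicat_real A \<omega> \<partial>M)"
      by (simp add: set_lebesgue_integral_def indicator_inter_arith[symmetric] mult.left_commute)
    finally show "(\<integral>\<omega>\<in>D. indicat_real (A \<inter> C) \<omega> \<partial>M) = (\<integral>\<omega>\<in>D. prob C * indicat_real A \<omega> \<partial>M)" .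
  next
    have "A \<in> sets (sigma (space M) y)" using A sub_sigma_field_sets[OF y] by simp
    then show "(\<lambda>\<omega>. prob C * indicat_real A \<omega>) \<in> borel_measurable (sigma (space M) y)" by simp
  qed (auto intro!: integrable_indicat)
qed

text \<open>
  To a function of \<open>a\<close> and \<open>b\<close>, the information in \<open>y\<close> beyond \<open>a\<close> contributes nothing if \<open>b\<close> is independent
  of all of \<open>y\<close>. On the generating rectangles both sides are given by the preceding lemma, applied
  to \<open>y\<close> and to \<open>a\<close>.
\<close>
lemma CE_eq_of_independent:
  assumes y: "y \<in> sub_sigma_fields M" and a: "a \<in> sub_sigma_fields M" and b: "b \<in> sub_sigma_fields M"
    and ay: "a \<subseteq> y" and ind: "indep_set y b"
    and g: "integrable M g" "g \<in> borel_measurable (sigma (space M) (sf_sup M a b))"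
  shows "AE \<omega> in M. CE y g \<omega> = CE a g \<omega>"
proof -
  define G where "G = {A \<inter> C | A C. A \<in> a \<and> C \<in> b}"
  note G = sf_sup_eq_sigma_sets_rectangles[OF a b, folded G_def]
  have gG: "g \<in> borel_measurable (sigma (space M) G)"
    using measurable_sigma_eq[OF G(1,3) _ g(2)] sub_sigma_field_subset[OF sf_sup_in_sub_sigma_fields[OF a b]]
    by blast
  have inda: "indep_set a b"
    unfolding indep_set_def using ind ay unfolding indep_set_def
    by (elim indep_sets_mono_sets) (auto split: bool.splits)
  show ?thesis
    using G(2,3,4) g(1) gG
  proof (induction g rule: integrable_generator_induct)
    case (basic X)
    then obtain A C where X: "A \<in> a" "C \<in> b" "X = A \<inter> C" unfolding G_def by blast
    then have "A \<in> y" using ay by blast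
    show ?case
      unfolding X(3) using CE_indep_rectangle[OF y ind \<open>A \<in> y\<close> X(2)] CE_indep_rectangle[OF a inda X(1,2)]
      by eventually_elim simp
  next
    case (lin c d f h)
    show ?case
      using CE_lin[OF y lin(1,2), of c d] CE_lin[OF a lin(1,2), of c d] lin(3,4)
      by eventually_elim simp
  next
    case (lim f s)
    note int = CE_integrable[OF y lim(1)] CE_integrable[OF a lim(1)] CE_integrable[OF y lim(2)] CE_integrable[OF a lim(2)]
    have le: "dist1 (CE y f) (CE a f) \<le> 2 * dist1 (s n) f" for n
    proof -
      have "dist1 (CE y f) (CE a f) \<le> dist1 (CE y f) (CE y (s n)) + dist1 (CE y (s n)) (CE a f)"
        using int by (intro dist1_triangle)
      also have "dist1 (CE y (s n)) (CE a f) = dist1 (CE a (s n)) (CE a f)"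
        using int lim.IH by (intro dist1_cong_AE) auto
      also have "\<dots> \<le> dist1 (s n) f" using CE_contraction[OF a lim(2) lim(1)] .
      also have "dist1 (CE y f) (CE y (s n)) \<le> dist1 (s n) f"
        using CE_contraction[OF y lim(1) lim(2)] by (simp add: dist1_commute)
      finally show ?thesis by simp
    qed
    have "(\<lambda>n. 2 * dist1 (s n) f) \<longlonglongrightarrow> 0" using tendsto_mult_right_zero[OF lim.hyps(3)] .
    then have "dist1 (CE y f) (CE a f) \<le> 0"
      by (rule LIMSEQ_le_const) (use le in blast)
    then have "dist1 (CE y f) (CE a f) = 0" using dist1_nonneg by (simp add: antisym)
    then show ?case using dist1_eq_0_iff int by blast
  qed
qed

section \<open>Increasing sequences of $\sigma$-fields\<close>

text \<open>
  The contraction property makes convergence of conditional expectations of \<open>g\<close> to \<open>g\<close> itself a closed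
  linear condition on \<open>g\<close>. An arbitrary filter covers both sequences and, below, the joins of two
  approximating families.
\<close>
lemma tendsto_CE_self_of_generator:
  assumes W: "eventually (\<lambda>i. W i \<in> sub_sigma_fields M) F"
    and G: "Int_stable G" "G \<subseteq> sets M" "space M \<in> G"
    and basic: "\<And>A. A \<in> G \<Longrightarrow> ((\<lambda>i. dist1 (CE (W i) (indicat_real A)) (indicat_real A)) \<longlongrightarrow> 0) F"
    and g: "integrable M g" "g \<in> borel_measurable (sigma (space M) G)"
  shows "((\<lambda>i. dist1 (CE (W i) g) g) \<longlongrightarrow> 0) F"
  using G g
proof (induction g rule: integrable_generator_induct)
  case (basic A)
  then show ?case by (rule assms(5))
next
  case (lin c d f h)
  have "((\<lambda>i. \<bar>c\<bar> * dist1 (CE (W i) f) f + \<bar>d\<bar> * dist1 (CE (W i) h) h) \<longlongrightarrow> \<bar>c\<bar> * 0 + \<bar>d\<bar> * 0) F"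
    using lin by (intro tendsto_intros)
  moreover have "eventually (\<lambda>i. dist1 (CE (W i) (\<lambda>\<omega>. c * f \<omega> + d * h \<omega>)) (\<lambda>\<omega>. c * f \<omega> + d * h \<omega>)
      \<le> \<bar>c\<bar> * dist1 (CE (W i) f) f + \<bar>d\<bar> * dist1 (CE (W i) h) h) F"
    using W
  proof eventually_elim
    case (elim i)
    note int = CE_integrable[OF elim lin(1)] CE_integrable[OF elim lin(2)] lin(1,2)
    have "dist1 (CE (W i) (\<lambda>\<omega>. c * f \<omega> + d * h \<omega>)) (\<lambda>\<omega>. c * f \<omega> + d * h \<omega>)
      \<le> expectation (\<lambda>\<omega>. \<bar>c\<bar> * \<bar>CE (W i) f \<omega> - f \<omega>\<bar> + \<bar>d\<bar> * \<bar>CE (W i) h \<omega> - h \<omega>\<bar>)"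
      unfolding dist1_def
    proof (rule integral_mono_AE)
      show "integrable M (\<lambda>\<omega>. \<bar>CE (W i) (\<lambda>\<omega>. c * f \<omega> + d * h \<omega>) \<omega> - (c * f \<omega> + d * h \<omega>)\<bar>)"
        using lin(1,2) by (intro integrable_abs Bochner_Integration.integrable_diff CE_integrable[OF elim]) auto
      show "AE \<omega> in M. \<bar>CE (W i) (\<lambda>\<omega>. c * f \<omega> + d * h \<omega>) \<omega> - (c * f \<omega> + d * h \<omega>)\<bar>
          \<le> \<bar>c\<bar> * \<bar>CE (W i) f \<omega> - f \<omega>\<bar> + \<bar>d\<bar> * \<bar>CE (W i) h \<omega> - h \<omega>\<bar>"
        using CE_lin[OF elim lin(1,2), of c d]
      proof eventually_elim
        case (elim \<omega>)
        have "CE (W i) (\<lambda>\<omega>. c * f \<omega> + d * h \<omega>) \<omega> - (c * f \<omega> + d * h \<omega>)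
            = c * (CE (W i) f \<omega> - f \<omega>) + d * (CE (W i) h \<omega> - h \<omega>)"
          using elim by (simp add: algebra_simps)
        then show ?case by (metis abs_mult abs_triangle_ineq)
      qed
    qed (use int in auto)
    also have "\<dots> = \<bar>c\<bar> * dist1 (CE (W i) f) f + \<bar>d\<bar> * dist1 (CE (W i) h) h"
      unfolding dist1_def using int by simp
    finally show ?case .
  qed
  ultimately show ?case
    using tendsto_sandwich[OF always_eventually[OF allI[OF dist1_nonneg]] _ tendsto_const]
    by simp
next
  case (lim f s)
  show ?case
  proof (rule tendsto_0_dist1I)
    fix \<epsilon> :: real assume "0 < \<epsilon>"
    then obtain n where n: "dist1 (s n) f < \<epsilon> / 3"
      using tendsto_0_dist1D[OF lim.hyps(3), of "\<epsilon> / 3"] by (auto simp: eventually_sequentially)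
    have "eventually (\<lambda>i. dist1 (CE (W i) (s n)) (s n) < \<epsilon> / 3) F"
      using \<open>0 < \<epsilon>\<close> by (intro tendsto_0_dist1D[OF lim.IH]) simp
    then show "eventually (\<lambda>i. dist1 (CE (W i) f) f < \<epsilon>) F"
      using W
    proof eventually_elim
      case (elim i)
      note int = CE_integrable[OF elim(2) lim(1)] CE_integrable[OF elim(2) lim(2)] lim(1,2)
      have "dist1 (CE (W i) f) f \<le> dist1 (CE (W i) f) (CE (W i) (s n)) + dist1 (CE (W i) (s n)) f"
        using int by (intro dist1_triangle)
      also have "dist1 (CE (W i) (s n)) f \<le> dist1 (CE (W i) (s n)) (s n) + dist1 (s n) f"
        using int by (intro dist1_triangle)
      also have "dist1 (CE (W i) f) (CE (W i) (s n)) \<le> dist1 (s n) f"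
        using CE_contraction[OF elim(2) lim(1) lim(2)] by (simp add: dist1_commute)
      finally show ?case using elim n by simp
    qed
  qed
qed

text \<open>
  Martingale convergence in $L_1$. A set in the union of the \<open>W n\<close> is eventually in \<open>W n\<close>, and these sets
  generate the supremum; by the tower property \<open>g\<close> may be replaced by its conditional expectation
  given the supremum.
\<close>
lemma tendsto_CE_incseq:
  assumes W: "\<And>n. W n \<in> sub_sigma_fields M" and "incseq W" and g: "integrable M g"
  shows "(\<lambda>n. dist1 (CE (W n) g) (CE (sf_Sup M (range W)) g)) \<longlonglongrightarrow> 0"
proof -
  define y where "y = sf_Sup M (range W)"
  define G where "G = (\<Union>n. W n)"
  have y: "y \<in> sub_sigma_fields M" unfolding y_def using W by (intro sf_Sup_in_sub_sigma_fields) auto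
  have Wy: "W n \<subseteq> y" for n unfolding y_def sf_Sup_def sf_generated_def by (auto intro: sigma_sets.Basic)
  have "null_sets M \<subseteq> G" using W[of 0] unfolding G_def sub_sigma_fields_def by blast
  then have yG: "y = sigma_sets (space M) G"
    unfolding y_def sf_Sup_def sf_generated_def G_def by (simp add: Un_absorb2)
  have G: "G \<subseteq> sets M" "space M \<in> G"
    unfolding G_def using W sub_sigma_field_subset sub_sigma_field_space by blast+
  have "Int_stable G"
  proof (rule Int_stableI)
    fix A C assume "A \<in> G" "C \<in> G"
    then obtain m n where "A \<in> W m" "C \<in> W n" unfolding G_def by blast
    then have "A \<in> W (max m n)" "C \<in> W (max m n)"
      using incseqD[OF \<open>incseq W\<close>] by (meson max.cobounded1 max.cobounded2 subsetD)+
    then show "A \<inter> C \<in> G" unfolding G_def using sub_sigma_field_Int[OF W] by blast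
  qed
  then have "(\<lambda>n. dist1 (CE (W n) (CE y g)) (CE y g)) \<longlonglongrightarrow> 0"
  proof (rule tendsto_CE_self_of_generator[rotated])
    fix A assume "A \<in> G"
    then obtain n where n: "A \<in> W n" unfolding G_def by blast
    have "dist1 (CE (W k) (indicat_real A)) (indicat_real A) = 0" if "n \<le> k" for k
    proof -
      have A: "A \<in> W k" using n incseqD[OF \<open>incseq W\<close> that] by blast
      have int: "integrable M (indicat_real A)"
        using integrable_indicat \<open>A \<in> G\<close> G by blast
      have "AE \<omega> in M. CE (W k) (indicat_real A) \<omega> = indicat_real A \<omega>"
        using A by (intro CE_measurable_id[OF W int] borel_measurable_indicator) (simp add: sub_sigma_field_sets[OF W])
      then show ?thesis using dist1_eq_0_iff[OF CE_integrable[OF W int] int] by blast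
    qed
    then show "(\<lambda>k. dist1 (CE (W k) (indicat_real A)) (indicat_real A)) \<longlonglongrightarrow> 0"
      by (intro tendsto_eventually) (auto simp: eventually_sequentially)
  next
    show "CE y g \<in> borel_measurable (sigma (space M) G)"
      using measurable_sigma_eq[OF yG G(1) sub_sigma_field_subset[OF y] CE_measurable] .
  qed (use W G CE_integrable[OF y g] in auto)
  moreover have "dist1 (CE (W n) (CE y g)) (CE y g) = dist1 (CE (W n) g) (CE y g)" for n
    using CE_tower[OF W y Wy g] W y g by (intro dist1_cong_AE) (auto intro!: CE_integrable)
  ultimately show ?thesis unfolding y_def by simp
qed

section \<open>Decreasing sequences of $\sigma$-fields\<close>

lemma L2_integrable: "f \<in> L2_functions M \<Longrightarrow> integrable M f"
  unfolding L2_functions_def using square_integrable_imp_integrable by blast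

lemma L2_mult_integrable:
  assumes "f \<in> L2_functions M" "g \<in> L2_functions M"
  shows "integrable M (\<lambda>\<omega>. f \<omega> * g \<omega>)"
proof (rule Bochner_Integration.integrable_bound)
  show "integrable M (\<lambda>\<omega>. (f \<omega>)\<^sup>2 + (g \<omega>)\<^sup>2)" using assms by (simp add: L2_functions_def)
  show "(\<lambda>\<omega>. f \<omega> * g \<omega>) \<in> borel_measurable M"
    using assms by (intro borel_measurable_times) (auto simp: L2_functions_def)
  have "\<bar>a * b\<bar> \<le> a\<^sup>2 + b\<^sup>2" for a b :: real
  proof -
    have "2 * \<bar>a * b\<bar> \<le> a\<^sup>2 + b\<^sup>2"
      using sum_squares_bound[of "\<bar>a\<bar>" "\<bar>b\<bar>"] by (simp add: abs_mult)
    then show ?thesis by linarith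
  qed
  then show "AE \<omega> in M. norm (f \<omega> * g \<omega>) \<le> norm ((f \<omega>)\<^sup>2 + (g \<omega>)\<^sup>2)" by simp
qed

lemma CE_L2:
  assumes x: "x \<in> sub_sigma_fields M" and f: "f \<in> L2_functions M"
  shows "CE x f \<in> L2_functions M"
proof -
  interpret sigma_finite_subalgebra M "sigma (space M) x"
    by (rule sigma_finite_subalgebra_sub_sigma_field[OF x])
  have "integrable M (\<lambda>\<omega>. (CE x f \<omega>)\<^sup>2)"
    unfolding cond_expectation_def
    by (rule integrable_convex_cond_exp[where I = UNIV])
       (use f L2_integrable[OF f] in \<open>auto simp: L2_functions_def convex_power2\<close>)
  then show ?thesis
    using measurable_sub_sigma_field[OF x CE_measurable] by (simp add: L2_functions_def)
qed

lemma dist1_power2_le: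
  assumes "f \<in> L2_functions M" "g \<in> L2_functions M"
  shows "(dist1 f g)\<^sup>2 \<le> expectation (\<lambda>\<omega>. (f \<omega> - g \<omega>)\<^sup>2)"
proof -
  have "integrable M (\<lambda>\<omega>. (f \<omega>)\<^sup>2 + (g \<omega>)\<^sup>2 - 2 * (f \<omega> * g \<omega>))"
    using assms L2_mult_integrable[OF assms] by (simp add: L2_functions_def)
  then have "integrable M (\<lambda>\<omega>. \<bar>f \<omega> - g \<omega>\<bar>\<^sup>2)"
    by (simp add: power2_diff algebra_simps)
  then show ?thesis
    using variance_positive[of "\<lambda>\<omega>. \<bar>f \<omega> - g \<omega>\<bar>"] variance_eq[of "\<lambda>\<omega>. \<bar>f \<omega> - g \<omega>\<bar>"]
      L2_integrable[OF assms(1)] L2_integrable[OF assms(2)]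
    unfolding dist1_def by simp
qed

text \<open>
  On $L_2$ conditional expectations are orthogonal projections, nested if the $\sigma$-fields are.
\<close>
lemma CE_pythagoras:
  assumes x: "x \<in> sub_sigma_fields M" and y: "y \<in> sub_sigma_fields M" and "x \<subseteq> y"
    and f: "f \<in> L2_functions M"
  shows "expectation (\<lambda>\<omega>. (CE y f \<omega> - CE x f \<omega>)\<^sup>2)
       = expectation (\<lambda>\<omega>. (CE y f \<omega>)\<^sup>2) - expectation (\<lambda>\<omega>. (CE x f \<omega>)\<^sup>2)"
proof -
  interpret sigma_finite_subalgebra M "sigma (space M) x"
    by (rule sigma_finite_subalgebra_sub_sigma_field[OF x])
  note xf = CE_L2[OF x f] and yf = CE_L2[OF y f]
  have prod: "integrable M (\<lambda>\<omega>. CE x f \<omega> * CE y f \<omega>)" using L2_mult_integrable[OF xf yf] .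
  have "expectation (\<lambda>\<omega>. CE x f \<omega> * CE y f \<omega>) = expectation (\<lambda>\<omega>. CE x f \<omega> * CE x (CE y f) \<omega>)"
    using real_cond_exp_intg(2)[OF prod CE_measurable] L2_integrable[OF yf]
    by (simp add: cond_expectation_def)
  also have "\<dots> = expectation (\<lambda>\<omega>. (CE x f \<omega>)\<^sup>2)"
  proof (rule integral_cong_AE)
    show "AE \<omega> in M. CE x f \<omega> * CE x (CE y f) \<omega> = (CE x f \<omega>)\<^sup>2"
      using CE_tower[OF x y \<open>x \<subseteq> y\<close> L2_integrable[OF f]] by eventually_elim (simp add: power2_eq_square)
    show "(\<lambda>\<omega>. CE x f \<omega> * CE x (CE y f) \<omega>) \<in> borel_measurable M" "(\<lambda>\<omega>. (CE x f \<omega>)\<^sup>2) \<in> borel_measurable M"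
      using measurable_sub_sigma_field[OF x CE_measurable] by simp_all
  qed
  finally have eq: "expectation (\<lambda>\<omega>. CE x f \<omega> * CE y f \<omega>) = expectation (\<lambda>\<omega>. (CE x f \<omega>)\<^sup>2)" .
  have "expectation (\<lambda>\<omega>. (CE y f \<omega> - CE x f \<omega>)\<^sup>2)
      = expectation (\<lambda>\<omega>. (CE y f \<omega>)\<^sup>2 + (CE x f \<omega>)\<^sup>2 - 2 * (CE x f \<omega> * CE y f \<omega>))"
    by (simp add: power2_diff algebra_simps)
  also have "\<dots> = expectation (\<lambda>\<omega>. (CE y f \<omega>)\<^sup>2) + expectation (\<lambda>\<omega>. (CE x f \<omega>)\<^sup>2)
      - 2 * expectation (\<lambda>\<omega>. CE x f \<omega> * CE y f \<omega>)"
    using prod xf yf by (simp add: L2_functions_def)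
  finally show ?thesis using eq by simp
qed

text \<open>
  Completeness of $L_1$, with the limit given as a pointwise one. A tail of the sequence has the same
  pointwise limit at every point, so the limit inherits exact, not only almost everywhere,
  measurability with respect to each $\sigma$-field for which the sequence is eventually measurable.
\<close>
lemma dist1_lim:
  assumes s: "\<And>j. integrable M (s j)" and small: "\<And>j::nat. dist1 (s j) (s (Suc j)) \<le> (1/2) ^ j"
  defines "h \<equiv> \<lambda>\<omega>. lim (\<lambda>j. s j \<omega>)"
  shows "integrable M h" and "(\<lambda>j. dist1 (s j) h) \<longlonglongrightarrow> 0"
proof -
  define t where "t j \<omega> = s (Suc j) \<omega> - s j \<omega>" for j \<omega>
  have t[measurable]: "t j \<in> borel_measurable M" "integrable M (t j)" for j
    unfolding t_def using s by auto
  have [measurable]: "s j \<in> borel_measurable M" for j using s by auto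
  have h[measurable]: "h \<in> borel_measurable M" unfolding h_def by measurable
  have norm_t: "expectation (\<lambda>\<omega>. \<bar>t j \<omega>\<bar>) = dist1 (s j) (s (Suc j))" for j
    unfolding t_def dist1_def by (simp add: abs_minus_commute)
  have geo: "summable (\<lambda>j. (1/2 :: real) ^ j)" by (rule summable_geometric) simp
  then have summ: "summable (\<lambda>j. expectation (\<lambda>\<omega>. \<bar>t j \<omega>\<bar>))"
    by (rule summable_comparison_test'[where N = 0]) (use small dist1_nonneg norm_t in simp)
  have "(\<integral>\<^sup>+\<omega>. (\<Sum>j. ennreal \<bar>t j \<omega>\<bar>) \<partial>M) = (\<Sum>j. \<integral>\<^sup>+\<omega>. ennreal \<bar>t j \<omega>\<bar> \<partial>M)"
    by (rule nn_integral_suminf) simp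
  also have "\<dots> = (\<Sum>j. ennreal (expectation (\<lambda>\<omega>. \<bar>t j \<omega>\<bar>)))"
    using t(2) by (intro arg_cong[where f = suminf] ext nn_integral_eq_integral) auto
  also have "\<dots> = ennreal (\<Sum>j. expectation (\<lambda>\<omega>. \<bar>t j \<omega>\<bar>))"
    using summ by (intro suminf_ennreal2) auto
  finally have "(\<integral>\<^sup>+\<omega>. (\<Sum>j. ennreal \<bar>t j \<omega>\<bar>) \<partial>M) \<noteq> \<infinity>" by simp
  then have "AE \<omega> in M. (\<Sum>j. ennreal \<bar>t j \<omega>\<bar>) \<noteq> \<infinity>"
    by (intro nn_integral_noteq_infinite) auto
  then have AE_summ: "AE \<omega> in M. summable (\<lambda>j. \<bar>t j \<omega>\<bar>)"
    by eventually_elim (rule summable_suminf_not_top, auto)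
  define w where "w \<omega> = \<bar>s 0 \<omega>\<bar> + (\<Sum>j. \<bar>t j \<omega>\<bar>)" for \<omega>
  have w: "integrable M w"
    unfolding w_def using s t AE_summ summ
    by (intro Bochner_Integration.integrable_add integrable_suminf) auto
  have conv: "AE \<omega> in M. (\<lambda>j. s j \<omega>) \<longlonglongrightarrow> h \<omega> \<and> (\<forall>j. \<bar>s j \<omega>\<bar> \<le> w \<omega>)"
    using AE_summ
  proof eventually_elim
    case (elim \<omega>)
    have s_eq: "s n \<omega> = s 0 \<omega> + (\<Sum>j<n. t j \<omega>)" for n
      unfolding t_def using sum_lessThan_telescope[of "\<lambda>j. s j \<omega>" n] by simp
    have "(\<lambda>n. s 0 \<omega> + (\<Sum>j<n. t j \<omega>)) \<longlonglongrightarrow> s 0 \<omega> + (\<Sum>j. t j \<omega>)"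
      using summable_LIMSEQ[OF summable_rabs_cancel[OF elim]] by (intro tendsto_intros)
    then have "convergent (\<lambda>n. s n \<omega>)" unfolding convergent_def s_eq[symmetric] by blast
    then have "(\<lambda>n. s n \<omega>) \<longlonglongrightarrow> h \<omega>" unfolding h_def by (simp add: convergent_LIMSEQ_iff)
    moreover have "\<bar>s n \<omega>\<bar> \<le> w \<omega>" for n
    proof -
      have "\<bar>s n \<omega>\<bar> \<le> \<bar>s 0 \<omega>\<bar> + (\<Sum>j<n. \<bar>t j \<omega>\<bar>)"
        using s_eq[of n] sum_abs[of "\<lambda>j. t j \<omega>" "{..<n}"] by linarith
      also have "(\<Sum>j<n. \<bar>t j \<omega>\<bar>) \<le> (\<Sum>j. \<bar>t j \<omega>\<bar>)"
        using elim by (intro sum_le_suminf) auto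
      finally show ?thesis unfolding w_def by simp
    qed
    ultimately show ?case by blast
  qed
  show hi: "integrable M h"
    by (rule integrable_dominated_convergence[where s = s and w = w]) (use w conv in auto)
  have "(\<lambda>j. dist1 (s j) h) \<longlonglongrightarrow> expectation (\<lambda>_. 0)"
    unfolding dist1_def
  proof (rule integral_dominated_convergence[where w = "\<lambda>\<omega>. w \<omega> + \<bar>h \<omega>\<bar>"])
    show "AE \<omega> in M. (\<lambda>j. \<bar>s j \<omega> - h \<omega>\<bar>) \<longlonglongrightarrow> 0"
      using conv by eventually_elim (auto intro!: tendsto_rabs_zero LIM_zero)
    show "AE \<omega> in M. norm \<bar>s j \<omega> - h \<omega>\<bar> \<le> w \<omega> + \<bar>h \<omega>\<bar>" for j
      using conv
    proof eventually_elim
      case (elim \<omega>)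
      then have "\<bar>s j \<omega>\<bar> \<le> w \<omega>" by blast
      then show ?case by simp
    qed
  qed (use w hi in auto)
  then show "(\<lambda>j. dist1 (s j) h) \<longlonglongrightarrow> 0" by simp
qed

text \<open>
  Reverse martingale convergence. The $L_2$ norms of the conditional expectations decrease, so by
  Pythagoras the sequence is Cauchy. The limit \<open>h\<close> of a fast subsequence is measurable
  with respect to every \<open>W n\<close>, hence to the infimum \<open>y\<close>, and conditioning on \<open>y\<close> identifies it with the
  conditional expectation of \<open>g\<close> given \<open>y\<close>.
\<close>
lemma tendsto_CE_decseq:
  assumes W: "\<And>n. W n \<in> sub_sigma_fields M" and dec: "decseq W" and g: "g \<in> L2_functions M"
  shows "(\<lambda>n. dist1 (CE (W n) g) (CE (sf_Inf M (range W)) g)) \<longlonglongrightarrow> 0"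
proof -
  define y where "y = sf_Inf M (range W)"
  have y: "y \<in> sub_sigma_fields M" unfolding y_def using W by (intro sf_Inf_in_sub_sigma_fields) auto
  have yW: "y \<subseteq> W n" for n unfolding y_def sf_Inf_def by blast
  note gi = L2_integrable[OF g]
  define c where "c n = expectation (\<lambda>\<omega>. (CE (W n) g \<omega>)\<^sup>2)" for n
  have dist_le: "(dist1 (CE (W m) g) (CE (W n) g))\<^sup>2 \<le> c m - c n" if "m \<le> n" for m n
    using dist1_power2_le[OF CE_L2[OF W g] CE_L2[OF W g], of m n]
      CE_pythagoras[OF W W decseqD[OF dec that] g]
    unfolding c_def by simp
  have "decseq c"
    unfolding decseq_def using dist_le by (meson diff_ge_0_iff_ge order_trans zero_le_power2)
  moreover have "0 \<le> c n" for n unfolding c_def by simp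
  ultimately have "Cauchy c"
    using decseq_convergent[of c 0] LIMSEQ_imp_Cauchy by metis
  then have "\<exists>N. \<forall>m\<ge>N. \<forall>n\<ge>N. \<bar>c m - c n\<bar> < ((1/2) ^ j)\<^sup>2" for j
    using CauchyD[of c "((1/2) ^ j)\<^sup>2"] by simp
  then obtain N where N: "\<And>j m n. N j \<le> m \<Longrightarrow> N j \<le> n \<Longrightarrow> \<bar>c m - c n\<bar> < ((1/2) ^ j)\<^sup>2"
    by metis
  \<comment> \<open>The summand \<open>j\<close> makes the subsequence leave every initial segment.\<close>
  define r where "r j = (\<Sum>i\<le>j. N i) + j" for j
  have Nr: "N j \<le> r j" "j \<le> r j" "r j \<le> r (Suc j)" for j
    unfolding r_def by (auto intro: trans_le_add1 member_le_sum)
  define h where "h = (\<lambda>\<omega>. lim (\<lambda>j. CE (W (r j)) g \<omega>))"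
  have "dist1 (CE (W (r j)) g) (CE (W (r (Suc j))) g) \<le> (1/2) ^ j" for j
  proof (rule power2_le_imp_le)
    show "(dist1 (CE (W (r j)) g) (CE (W (r (Suc j))) g))\<^sup>2 \<le> ((1/2) ^ j)\<^sup>2"
      using dist_le[OF Nr(3)[of j]] N[OF Nr(1)[of j] order_trans[OF Nr(1,3)[of j]]] by linarith
  qed simp
  then have h: "integrable M h" "(\<lambda>j. dist1 (CE (W (r j)) g) h) \<longlonglongrightarrow> 0"
    unfolding h_def using dist1_lim[of "\<lambda>j. CE (W (r j)) g"] CE_integrable[OF W gi] by blast+
  have "h \<in> borel_measurable (sigma (space M) (W n))" for n
  proof -
    have "(\<lambda>j. X (j + n)) \<longlonglongrightarrow> l \<longleftrightarrow> X \<longlonglongrightarrow> l" for X and l :: real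
      using LIMSEQ_offset LIMSEQ_ignore_initial_segment by blast
    then have shift: "lim (\<lambda>j. X (j + n)) = lim X" for X :: "nat \<Rightarrow> real"
      by (simp add: lim_def)
    have "h = (\<lambda>\<omega>. lim (\<lambda>j. CE (W (r (j + n))) g \<omega>))"
      unfolding h_def by (rule ext) (rule shift[symmetric])
    moreover have "CE (W (r (j + n))) g \<in> borel_measurable (sigma (space M) (W n))" for j
      using Nr(2)[of "j + n"] by (intro CE_measurable_mono W decseqD[OF dec]) linarith
    ultimately show ?thesis by simp
  qed
  then have hy: "h \<in> borel_measurable (sigma (space M) y)"
    unfolding y_def using W borel_measurable_integrable[OF h(1)] by (intro measurable_sf_Inf) blast+
  \<comment> \<open>Conditioning on a smaller \<open>W n\<close> only contracts, so closeness along the subsequence is enough.\<close>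
  have le: "dist1 (CE (W n) g) (CE y g) \<le> 2 * dist1 (CE (W (r j)) g) h" if "r j \<le> n" for j n
  proof -
    note int = CE_integrable[OF W gi] CE_integrable[OF y gi] h(1)
    have "dist1 (CE (W n) g) (CE y g) = dist1 (CE (W n) (CE (W (r j)) g)) (CE (W n) (CE y g))"
      using AE_symmetric[OF CE_tower[OF W W decseqD[OF dec that] gi]]
        AE_symmetric[OF CE_tower_le[OF y W yW gi]] int gi
      by (intro dist1_cong_AE CE_integrable[OF W])
    also have "\<dots> \<le> dist1 (CE (W (r j)) g) (CE y g)"
      using int by (intro CE_contraction W)
    also have "\<dots> \<le> dist1 (CE (W (r j)) g) h + dist1 h (CE y g)"
      using int by (intro dist1_triangle)
    also have "dist1 h (CE y g) = dist1 (CE y h) (CE y (CE (W (r j)) g))"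
      using AE_symmetric[OF CE_tower[OF y W yW gi]] AE_symmetric[OF CE_measurable_id[OF y h(1) hy]] int gi
      by (intro dist1_cong_AE CE_integrable[OF y])
    also have "\<dots> \<le> dist1 (CE (W (r j)) g) h"
      using CE_contraction[OF y h(1) int(1)] by (simp add: dist1_commute)
    finally show ?thesis by simp
  qed
  have "(\<lambda>n. dist1 (CE (W n) g) (CE y g)) \<longlonglongrightarrow> 0"
  proof (rule tendsto_0_dist1I)
    fix \<epsilon> :: real assume "0 < \<epsilon>"
    then obtain j where "dist1 (CE (W (r j)) g) h < \<epsilon> / 2"
      using tendsto_0_dist1D[OF h(2), of "\<epsilon> / 2"] by (auto simp: eventually_sequentially)
    then have "dist1 (CE (W n) g) (CE y g) < \<epsilon>" if "r j \<le> n" for n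
      using le[OF that] by linarith
    then show "\<forall>\<^sub>F n in sequentially. dist1 (CE (W n) g) (CE y g) < \<epsilon>"
      by (auto simp: eventually_sequentially)
  qed
  then show ?thesis unfolding y_def .
qed

section \<open>Approximation of the closure\<close>

lemma subset_sf_closure:
  assumes BL: "B \<subseteq> sub_sigma_fields M"
  shows "B \<subseteq> sf_closure M B"
proof
  fix x assume x: "x \<in> B"
  then have xL: "x \<in> sub_sigma_fields M" using BL by blast
  have "sf_liminf M (\<lambda>_. x) = x"
    using sub_sigma_field_subset[OF xL] sub_sigma_field_sigma_sets[OF xL] xL
    by (simp add: sf_liminf_def sf_Inf_def sf_Sup_def sf_generated_def Int_absorb1 Un_absorb2 sub_sigma_fields_def)
  then show "x \<in> sf_closure M B"
    unfolding sf_closure_def using x by (intro CollectI exI[of _ "\<lambda>_. x"]) simp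
qed

text \<open>
  With \<open>u n m\<close> the intersection of \<open>x n, \<dots>, x (n + m)\<close>, the lower limit arises by letting first \<open>m\<close> and
  then \<open>n\<close> tend to infinity. How large \<open>m\<close> has to be depends on \<open>n\<close> and on \<open>g\<close>; the filter of the iterated
  limit serves all \<open>g\<close> at once and saves the choice of a diagonal sequence.
\<close>
lemma sf_closure_filter:
  assumes BL: "B \<subseteq> sub_sigma_fields M" and BI: "\<And>u v. u \<in> B \<Longrightarrow> v \<in> B \<Longrightarrow> u \<inter> v \<in> B"
    and y: "y \<in> sf_closure M B"
  obtains F where "F \<noteq> bot" "eventually (\<lambda>u. u \<in> B) F"
    "\<And>g. g \<in> L2_functions M \<Longrightarrow> ((\<lambda>u. dist1 (CE u g) (CE y g)) \<longlongrightarrow> 0) F"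
proof -
  obtain x where x: "\<And>n. x n \<in> B" and yx: "y = sf_liminf M x"
    using y by (auto simp: sf_closure_def)
  define u where "u n m = (\<Inter>k\<le>m. x (n + k))" for n m :: nat
  define Y where "Y n = sf_Inf M (range (\<lambda>k. x (n + k)))" for n
  have uB: "u n m \<in> B" for n m
  proof (induction m)
    case (Suc m)
    have "u n (Suc m) = u n m \<inter> x (n + Suc m)" unfolding u_def by (auto simp: atMost_Suc)
    then show ?case using BI[OF Suc x] by simp
  qed (simp add: u_def x)
  have "decseq (u n)" for n unfolding decseq_def u_def by force
  have Yu: "Y n = sf_Inf M (range (u n))" for n
    unfolding Y_def sf_Inf_def u_def by auto
  have YL: "Y n \<in> sub_sigma_fields M" for n
    unfolding Y_def using BL x by (intro sf_Inf_in_sub_sigma_fields) auto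
  have "incseq Y"
  proof (rule incseq_SucI)
    fix n
    have "x (Suc n + k) = x (n + Suc k)" for k by simp
    then show "Y n \<subseteq> Y (Suc n)" unfolding Y_def sf_Inf_def by (auto simp del: add_Suc_right)
  qed
  have yY: "y = sf_Sup M (range Y)" unfolding yx sf_liminf_def Y_def ..
  have yL: "y \<in> sub_sigma_fields M"
    unfolding yY using YL by (intro sf_Sup_in_sub_sigma_fields) auto
  define F where "F = Abs_filter (\<lambda>P. \<forall>\<^sub>F n in sequentially. \<forall>\<^sub>F m in sequentially. P (u n m))"
  have F: "eventually P F \<longleftrightarrow> (\<forall>\<^sub>F n in sequentially. \<forall>\<^sub>F m in sequentially. P (u n m))" for P
    unfolding F_def
  proof (rule eventually_Abs_filter, rule is_filter.intro)
    fix P Q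
    assume "\<forall>\<^sub>F n in sequentially. \<forall>\<^sub>F m in sequentially. P (u n m)"
      and "\<forall>\<^sub>F n in sequentially. \<forall>\<^sub>F m in sequentially. Q (u n m)"
    then show "\<forall>\<^sub>F n in sequentially. \<forall>\<^sub>F m in sequentially. P (u n m) \<and> Q (u n m)"
      by eventually_elim (rule eventually_conj)
  next
    fix P Q
    assume imp: "\<forall>v. P v \<longrightarrow> Q v" and "\<forall>\<^sub>F n in sequentially. \<forall>\<^sub>F m in sequentially. P (u n m)"
    from this(2) show "\<forall>\<^sub>F n in sequentially. \<forall>\<^sub>F m in sequentially. Q (u n m)"
      by eventually_elim (use imp in \<open>auto elim: eventually_mono\<close>)
  qed simp
  show thesis
  proof (rule that[of F])
    show "F \<noteq> bot" unfolding trivial_limit_def F by simp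
    show "eventually (\<lambda>u. u \<in> B) F" unfolding F using uB by simp
    fix g assume g: "g \<in> L2_functions M"
    note gi = L2_integrable[OF g]
    have uL: "u n m \<in> sub_sigma_fields M" for n m using uB BL by blast
    show "((\<lambda>u. dist1 (CE u g) (CE y g)) \<longlongrightarrow> 0) F"
    proof (rule tendsto_0_dist1I)
      fix \<epsilon> :: real assume \<epsilon>: "0 < \<epsilon>"
      have "\<forall>\<^sub>F n in sequentially. dist1 (CE (Y n) g) (CE y g) < \<epsilon> / 2"
        unfolding yY using \<epsilon> by (intro tendsto_0_dist1D[OF tendsto_CE_incseq[OF YL \<open>incseq Y\<close> gi]]) simp
      then show "\<forall>\<^sub>F u in F. dist1 (CE u g) (CE y g) < \<epsilon>"
        unfolding F
      proof eventually_elim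
        case (elim n)
        have "\<forall>\<^sub>F m in sequentially. dist1 (CE (u n m) g) (CE (Y n) g) < \<epsilon> / 2"
          unfolding Yu using \<epsilon>
          by (intro tendsto_0_dist1D[OF tendsto_CE_decseq[OF uL \<open>decseq (u n)\<close> g]]) simp
        then show ?case
        proof eventually_elim
          case (elim m)
          have "dist1 (CE (u n m) g) (CE y g) \<le> dist1 (CE (u n m) g) (CE (Y n) g) + dist1 (CE (Y n) g) (CE y g)"
            by (intro dist1_triangle CE_integrable uL YL yL gi)
          then show ?case using elim \<open>dist1 (CE (Y n) g) (CE y g) < \<epsilon> / 2\<close> by simp
        qed
      qed
    qed
  qed
qed

text \<open>
  The join is continuous at a pair that generates everything. On a rectangle \<open>A \<inter> C\<close> the product of
  the conditional expectations of the two indicators, given \<open>u\<close> and given \<open>v\<close>, is measurable with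
  respect to the join of \<open>u\<close> and \<open>v\<close>, and it is close to the indicator of the rectangle.
\<close>
lemma tendsto_CE_sf_sup:
  assumes y: "y \<in> sub_sigma_fields M" and z: "z \<in> sub_sigma_fields M" and yz: "sf_sup M y z = sets M"
    and F1: "eventually (\<lambda>u. u \<in> sub_sigma_fields M) F1"
    and F2: "eventually (\<lambda>u. u \<in> sub_sigma_fields M) F2"
    and lim1: "\<And>g. g \<in> L2_functions M \<Longrightarrow> ((\<lambda>u. dist1 (CE u g) (CE y g)) \<longlongrightarrow> 0) F1"
    and lim2: "\<And>g. g \<in> L2_functions M \<Longrightarrow> ((\<lambda>v. dist1 (CE v g) (CE z g)) \<longlongrightarrow> 0) F2"
    and f: "integrable M f"
  shows "((\<lambda>p. dist1 (CE (sf_sup M (fst p) (snd p)) f) f) \<longlongrightarrow> 0) (F1 \<times>\<^sub>F F2)"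
proof -
  define G where "G = {A \<inter> C | A C. A \<in> y \<and> C \<in> z}"
  note G = sf_sup_eq_sigma_sets_rectangles[OF y z, folded G_def]
  have ev: "\<forall>\<^sub>F p in F1 \<times>\<^sub>F F2. fst p \<in> sub_sigma_fields M \<and> snd p \<in> sub_sigma_fields M"
    unfolding split_beta'[symmetric] using eventually_prodI[OF F1 F2] by simp
  have fG: "f \<in> borel_measurable (sigma (space M) G)"
  proof (rule measurable_sigma_eq[OF G(1,3)])
    show "f \<in> borel_measurable (sigma (space M) (sf_sup M y z))"
      unfolding yz using f by (rule measurable_sigma_events)
  qed (simp add: yz)
  show ?thesis
  proof (rule tendsto_CE_self_of_generator[OF _ G(2,3,4) _ f fG])
    show "\<forall>\<^sub>F p in F1 \<times>\<^sub>F F2. sf_sup M (fst p) (snd p) \<in> sub_sigma_fields M"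
      using ev by eventually_elim (simp add: sf_sup_in_sub_sigma_fields)
  next
    fix X assume "X \<in> G"
    then obtain A C where AC: "A \<in> y" "C \<in> z" and X: "X = A \<inter> C" unfolding G_def by blast
    have A[measurable]: "A \<in> sets M" and C[measurable]: "C \<in> sets M"
      using AC sub_sigma_field_subset y z by blast+
    note Ai = integrable_indicat[OF A] and Ci = integrable_indicat[OF C]
    have L2: "indicat_real D \<in> L2_functions M" if "D \<in> sets M" for D
      using that integrable_indicat[OF that] unfolding L2_functions_def
      by (simp add: power2_eq_square indicator_inter_arith[symmetric])
    have Ay: "AE \<omega> in M. CE y (indicat_real A) \<omega> = indicat_real A \<omega>"
      using AC by (intro CE_measurable_id[OF y Ai] borel_measurable_indicator) (simp add: sub_sigma_field_sets[OF y])
    have Cz: "AE \<omega> in M. CE z (indicat_real C) \<omega> = indicat_real C \<omega>"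
      using AC by (intro CE_measurable_id[OF z Ci] borel_measurable_indicator) (simp add: sub_sigma_field_sets[OF z])
    define e where "e p = dist1 (CE (fst p) (indicat_real A)) (CE y (indicat_real A))
        + dist1 (CE (snd p) (indicat_real C)) (CE z (indicat_real C))" for p
    have "(e \<longlongrightarrow> 0 + 0) (F1 \<times>\<^sub>F F2)"
      unfolding e_def
      by (intro tendsto_add filterlim_compose[OF lim1[OF L2[OF A]] filterlim_fst]
          filterlim_compose[OF lim2[OF L2[OF C]] filterlim_snd])
    then have e: "((\<lambda>p. 2 * e p) \<longlongrightarrow> 0) (F1 \<times>\<^sub>F F2)"
      by (intro tendsto_mult_right_zero) simp
    have "\<forall>\<^sub>F p in F1 \<times>\<^sub>F F2. dist1 (CE (sf_sup M (fst p) (snd p)) (indicat_real X)) (indicat_real X) \<le> 2 * e p"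
      using ev
    proof eventually_elim
      case (elim p)
      define u v w where "u = fst p" and "v = snd p" and "w = sf_sup M u v"
      have u: "u \<in> sub_sigma_fields M" and v: "v \<in> sub_sigma_fields M" using elim by (auto simp: u_def v_def)
      then have w: "w \<in> sub_sigma_fields M" unfolding w_def by (rule sf_sup_in_sub_sigma_fields)
      define a c where "a = CE u (indicat_real A)" and "c = CE v (indicat_real C)"
      have int: "integrable M a" "integrable M c" unfolding a_def c_def using CE_integrable u v Ai Ci by auto
      have cb: "AE \<omega> in M. \<bar>c \<omega>\<bar> \<le> 1" unfolding c_def by (rule CE_indicat_bounds[OF v C])
      have prod: "integrable M (\<lambda>\<omega>. a \<omega> * c \<omega>)"
      proof (rule Bochner_Integration.integrable_bound[OF int(1)])
        show "AE \<omega> in M. norm (a \<omega> * c \<omega>) \<le> norm (a \<omega>)"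
          using cb by eventually_elim (simp add: abs_mult mult_left_le)
      qed (use int in auto)
      have "a \<in> borel_measurable (sigma (space M) w)" "c \<in> borel_measurable (sigma (space M) w)"
        unfolding a_def c_def w_def using sf_sup_upper(1)[of u v] sf_sup_upper(2)[of v u] u v
        by (auto intro!: CE_measurable_mono sf_sup_in_sub_sigma_fields)
      then have "(\<lambda>\<omega>. a \<omega> * c \<omega>) \<in> borel_measurable (sigma (space M) w)" by (rule borel_measurable_times)
      then have "dist1 (CE w (indicat_real X)) (indicat_real X) \<le> 2 * dist1 (\<lambda>\<omega>. a \<omega> * c \<omega>) (indicat_real X)"
        using w prod X by (intro dist1_CE_le_twice) (auto intro!: integrable_indicat)
      also have "dist1 (\<lambda>\<omega>. a \<omega> * c \<omega>) (indicat_real X)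
          \<le> expectation (\<lambda>\<omega>. \<bar>a \<omega> - CE y (indicat_real A) \<omega>\<bar> + \<bar>c \<omega> - CE z (indicat_real C) \<omega>\<bar>)"
        unfolding dist1_def
      proof (rule integral_mono_AE)
        show "AE \<omega> in M. \<bar>a \<omega> * c \<omega> - indicat_real X \<omega>\<bar>
            \<le> \<bar>a \<omega> - CE y (indicat_real A) \<omega>\<bar> + \<bar>c \<omega> - CE z (indicat_real C) \<omega>\<bar>"
          using cb Ay Cz
        proof eventually_elim
          case (elim \<omega>)
          let ?A = "indicat_real A \<omega>" and ?C = "indicat_real C \<omega>"
          have "a \<omega> * c \<omega> - indicat_real X \<omega> = (a \<omega> - ?A) * c \<omega> + ?A * (c \<omega> - ?C)"
            unfolding X by (simp add: indicator_inter_arith algebra_simps)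
          then have "\<bar>a \<omega> * c \<omega> - indicat_real X \<omega>\<bar> \<le> \<bar>a \<omega> - ?A\<bar> * \<bar>c \<omega>\<bar> + ?A * \<bar>c \<omega> - ?C\<bar>"
            using abs_triangle_ineq[of "(a \<omega> - ?A) * c \<omega>" "?A * (c \<omega> - ?C)"] by (simp add: abs_mult)
          also have "\<dots> \<le> \<bar>a \<omega> - ?A\<bar> * 1 + 1 * \<bar>c \<omega> - ?C\<bar>"
            using elim(1) by (intro add_mono mult_mono) (auto simp: indicator_def)
          finally show ?case using elim by simp
        qed
        show "integrable M (\<lambda>\<omega>. \<bar>a \<omega> * c \<omega> - indicat_real X \<omega>\<bar>)"
          using prod X by (intro integrable_abs Bochner_Integration.integrable_diff integrable_indicat) auto
      qed (use int CE_integrable[OF y Ai] CE_integrable[OF z Ci] in auto)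
      also have "\<dots> = e p"
        unfolding dist1_def e_def a_def c_def u_def v_def
        using int CE_integrable[OF y Ai] CE_integrable[OF z Ci]
        by (intro Bochner_Integration.integral_add) (auto simp: a_def c_def u_def v_def)
      finally show ?case by (simp add: u_def v_def w_def)
    qed
    then show "((\<lambda>p. dist1 (CE (sf_sup M (fst p) (snd p)) (indicat_real X)) (indicat_real X)) \<longlongrightarrow> 0) (F1 \<times>\<^sub>F F2)"
      by (rule tendsto_sandwich[OF always_eventually[OF allI[OF dist1_nonneg]] _ tendsto_const e])
  qed
qed

section \<open>The first chaos and the closure\<close>

text \<open>
  By distributivity \<open>x\<close> is generated by \<open>x \<inter> y\<close>, which is part of \<open>y\<close>, and by \<open>x \<inter> y'\<close>, which is
  independent of \<open>y\<close>.
\<close>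
lemma CE_CE_eq_CE_Int:
  assumes B: "noise_type_boolean_algebra M B" and x: "x \<in> B" and y: "y \<in> B" and g: "integrable M g"
  shows "AE \<omega> in M. CE y (CE x g) \<omega> = CE (x \<inter> y) g \<omega>"
proof -
  define y' where "y' = complement_in M B y"
  have y': "y' \<in> B" "is_complement M y y'" using complement_in[OF B y] by (auto simp: y'_def)
  have L: "b \<in> sub_sigma_fields M" if "b \<in> B" for b using B that by (auto simp: noise_type_boolean_algebra_def)
  have I: "b \<inter> c \<in> B" if "b \<in> B" "c \<in> B" for b c using B that by (auto simp: noise_type_boolean_algebra_def)
  have "x = x \<inter> sf_sup M y y'"
    using y'(2) sub_sigma_field_subset[OF L[OF x]] by (auto simp: is_complement_def)
  also have "\<dots> = sf_sup M (x \<inter> y) (x \<inter> y')"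
    using B x y y'(1) by (simp add: noise_type_boolean_algebra_def)
  finally have x_eq: "x = sf_sup M (x \<inter> y) (x \<inter> y')" .
  have "indep_set y y'" using B y by (simp add: noise_type_boolean_algebra_def y'_def)
  then have ind: "indep_set y (x \<inter> y')"
    unfolding indep_set_def by (rule indep_sets_mono_sets) (auto split: bool.splits)
  have "AE \<omega> in M. CE y (CE x g) \<omega> = CE (x \<inter> y) (CE x g) \<omega>"
    using x y y' I L ind CE_integrable[OF L[OF x] g] CE_measurable[of g x] x_eq
    by (intro CE_eq_of_independent[where b = "x \<inter> y'"]) auto
  moreover have "AE \<omega> in M. CE (x \<inter> y) (CE x g) \<omega> = CE (x \<inter> y) g \<omega>"
    using x y I L g by (intro CE_tower) auto
  ultimately show ?thesis by eventually_elim simp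
qed

text \<open>
  Split \<open>f\<close> over \<open>u\<close> and its complement \<open>u'\<close>. The join meets \<open>u'\<close> in \<open>v \<inter> u'\<close>, so conditioning the second
  part on the join is the same as conditioning it on \<open>v\<close>.
\<close>
lemma first_chaos_sf_sup:
  assumes B: "noise_type_boolean_algebra M B" and f: "f \<in> first_chaos M B" and u: "u \<in> B" and v: "v \<in> B"
  shows "AE \<omega> in M. CE (sf_sup M u v) f \<omega> = CE u f \<omega> + CE v f \<omega> - CE v (CE u f) \<omega>"
proof -
  define u' where "u' = complement_in M B u"
  define w where "w = sf_sup M u v"
  have u': "u' \<in> B" "is_complement M u u'" using complement_in[OF B u] by (auto simp: u'_def)
  have L: "b \<in> sub_sigma_fields M" if "b \<in> B" for b using B that by (auto simp: noise_type_boolean_algebra_def)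
  have w: "w \<in> B" unfolding w_def using B u v by (auto simp: noise_type_boolean_algebra_def)
  have vu': "v \<inter> u' \<in> B" using B v u'(1) by (auto simp: noise_type_boolean_algebra_def)
  have fi: "integrable M f" using f by (auto simp: first_chaos_def intro: L2_integrable)
  have split: "AE \<omega> in M. f \<omega> = CE u f \<omega> + CE u' f \<omega>"
    using f u by (auto simp: first_chaos_def u'_def)
  note ui = CE_integrable[OF L[OF u] fi] and u'i = CE_integrable[OF L[OF u'(1)] fi]
  have "u' \<inter> w = sf_sup M (u' \<inter> u) (u' \<inter> v)"
    unfolding w_def using B u v u'(1) by (simp add: noise_type_boolean_algebra_def)
  also have "\<dots> = v \<inter> u'"
    using u'(2) sf_sup_bot[OF L[OF vu']] by (simp add: is_complement_def Int_commute)
  finally have u'w: "u' \<inter> w = v \<inter> u'" .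
  have "AE \<omega> in M. CE w f \<omega> = CE w (\<lambda>\<omega>. CE u f \<omega> + CE u' f \<omega>) \<omega>"
    using split ui u'i fi L[OF w] by (intro CE_cong) auto
  moreover have "AE \<omega> in M. CE w (\<lambda>\<omega>. CE u f \<omega> + CE u' f \<omega>) \<omega> = CE w (CE u f) \<omega> + CE w (CE u' f) \<omega>"
    by (rule CE_add[OF L[OF w] ui u'i])
  moreover have "AE \<omega> in M. CE w (CE u f) \<omega> = CE u f \<omega>"
    using sf_sup_upper(1) by (intro CE_tower_le L u w fi) (simp add: w_def)
  moreover have "AE \<omega> in M. CE w (CE u' f) \<omega> = CE (v \<inter> u') f \<omega>"
    using CE_CE_eq_CE_Int[OF B u'(1) w fi] unfolding u'w .
  moreover have "AE \<omega> in M. CE v (CE u' f) \<omega> = CE (v \<inter> u') f \<omega>"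
    using CE_CE_eq_CE_Int[OF B u'(1) v fi] by (simp add: Int_commute)
  moreover have "AE \<omega> in M. CE v (CE u' f) \<omega> = CE v (\<lambda>\<omega>. f \<omega> - CE u f \<omega>) \<omega>"
    using split ui u'i fi L[OF v] by (intro CE_cong) auto
  moreover have "AE \<omega> in M. CE v (\<lambda>\<omega>. f \<omega> - CE u f \<omega>) \<omega> = CE v f \<omega> - CE v (CE u f) \<omega>"
    by (rule CE_diff[OF L[OF v] fi ui])
  ultimately show ?thesis unfolding w_def[symmetric] by eventually_elim simp
qed

text \<open>
  The complement of the trivial $\sigma$-field is the full one, on which conditioning returns \<open>f\<close>.
\<close>
lemma first_chaos_centred:
  assumes B: "noise_type_boolean_algebra M B" and f: "f \<in> first_chaos M B"
  shows "AE \<omega> in M. CE (sf_bot M) f \<omega> = 0"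
proof -
  have L: "b \<in> sub_sigma_fields M" if "b \<in> B" for b using B that by (auto simp: noise_type_boolean_algebra_def)
  have bot: "sf_bot M \<in> B" using B by (simp add: noise_type_boolean_algebra_def)
  define t where "t = complement_in M B (sf_bot M)"
  have t: "t \<in> B" "is_complement M (sf_bot M) t" using complement_in[OF B bot] by (auto simp: t_def)
  have "t = sets M" using t(2) sf_sup_bot[OF L[OF t(1)]] by (simp add: is_complement_def)
  have fi: "integrable M f" using f by (auto simp: first_chaos_def intro: L2_integrable)
  have "AE \<omega> in M. CE t f \<omega> = f \<omega>"
    using measurable_sigma_events[OF fi] by (intro CE_measurable_id[OF L[OF t(1)] fi]) (simp add: \<open>t = sets M\<close>)
  moreover have "AE \<omega> in M. f \<omega> = CE (sf_bot M) f \<omega> + CE t f \<omega>"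
    using f bot by (auto simp: first_chaos_def t_def)
  ultimately show ?thesis by eventually_elim simp
qed

text \<open>
  The distance \<open>dist1 f h\<close> of the two sides does not depend on the approximating pair \<open>p\<close>, and it is
  bounded by the error \<open>e p\<close> that the inclusion-exclusion formula leaves at \<open>p\<close>, which tends to \<open>0\<close>.
\<close>
lemma first_chaos_split_closure:
  assumes B: "noise_type_boolean_algebra M B" and f: "f \<in> first_chaos M B"
    and y: "y \<in> sf_closure M B" "y \<in> sub_sigma_fields M"
    and z: "z \<in> sf_closure M B" "z \<in> sub_sigma_fields M"
    and ind: "indep_set z y" and sup: "sf_sup M y z = sets M"
  shows "AE \<omega> in M. f \<omega> = CE y f \<omega> + CE z f \<omega>"
proof -
  have BL: "B \<subseteq> sub_sigma_fields M" and BI: "\<And>u v. u \<in> B \<Longrightarrow> v \<in> B \<Longrightarrow> u \<inter> v \<in> B"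
    and bot: "sf_bot M \<in> B"
    using B by (auto simp: noise_type_boolean_algebra_def)
  have f2: "f \<in> L2_functions M" using f by (simp add: first_chaos_def)
  note fi = L2_integrable[OF f2]
  note yi = CE_integrable[OF y(2) fi] and zi = CE_integrable[OF z(2) fi]
  obtain F1 where F1: "F1 \<noteq> bot" "eventually (\<lambda>u. u \<in> B) F1"
    and lim1: "\<And>g. g \<in> L2_functions M \<Longrightarrow> ((\<lambda>u. dist1 (CE u g) (CE y g)) \<longlongrightarrow> 0) F1"
    using sf_closure_filter[OF BL BI y(1)] by blast
  obtain F2 where F2: "F2 \<noteq> bot" "eventually (\<lambda>u. u \<in> B) F2"
    and lim2: "\<And>g. g \<in> L2_functions M \<Longrightarrow> ((\<lambda>v. dist1 (CE v g) (CE z g)) \<longlongrightarrow> 0) F2"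
    using sf_closure_filter[OF BL BI z(1)] by blast
  let ?F = "F1 \<times>\<^sub>F F2"
  have "AE \<omega> in M. CE z (CE y f) \<omega> = CE (sf_bot M) (CE y f) \<omega>"
    using y z bot BL ind yi CE_measurable[of f y] sf_bot_subset[OF z(2)] sf_sup_bot[OF y(2)]
    by (intro CE_eq_of_independent[where b = y]) auto
  moreover have "AE \<omega> in M. CE (sf_bot M) (CE y f) \<omega> = CE (sf_bot M) f \<omega>"
    using bot BL y fi sf_bot_subset[OF y(2)] by (intro CE_tower) auto
  moreover note first_chaos_centred[OF B f]
  ultimately have zy0: "AE \<omega> in M. CE z (CE y f) \<omega> = 0" by eventually_elim simp
  define h where "h \<omega> = CE y f \<omega> + CE z f \<omega>" for \<omega>
  have hi: "integrable M h" unfolding h_def using yi zi by simp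
  define e where "e p = dist1 (CE (sf_sup M (fst p) (snd p)) f) f
      + dist1 (CE (fst p) f) (CE y f) + dist1 (CE (snd p) f) (CE z f)
      + dist1 (CE (fst p) f) (CE y f) + dist1 (CE (snd p) (CE y f)) (CE z (CE y f))" for p
  have fst0: "((\<lambda>p. dist1 (CE (fst p) g) (CE y g)) \<longlongrightarrow> 0) ?F" if "g \<in> L2_functions M" for g
    using filterlim_compose[OF lim1[OF that] filterlim_fst] .
  have snd0: "((\<lambda>p. dist1 (CE (snd p) g) (CE z g)) \<longlongrightarrow> 0) ?F" if "g \<in> L2_functions M" for g
    using filterlim_compose[OF lim2[OF that] filterlim_snd] .
  have "((\<lambda>p. dist1 (CE (sf_sup M (fst p) (snd p)) f) f) \<longlongrightarrow> 0) ?F"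
    using F1(2) F2(2) BL
    by (intro tendsto_CE_sf_sup[OF y(2) z(2) sup _ _ lim1 lim2 fi]) (auto elim!: eventually_mono)
  then have "(e \<longlongrightarrow> 0 + 0 + 0 + 0 + 0) ?F"
    unfolding e_def by (intro tendsto_add fst0 snd0 f2 CE_L2[OF y(2) f2])
  moreover have "\<forall>\<^sub>F p in ?F. fst p \<in> B \<and> snd p \<in> B"
    unfolding split_beta'[symmetric] using eventually_prodI[OF F1(2) F2(2)] by simp
  then have "\<forall>\<^sub>F p in ?F. dist1 f h \<le> e p"
  proof eventually_elim
    case (elim p)
    define u v where "u = fst p" and "v = snd p"
    have uB: "u \<in> B" and vB: "v \<in> B" using elim by (auto simp: u_def v_def)
    then have u: "u \<in> sub_sigma_fields M" and v: "v \<in> sub_sigma_fields M" using BL by auto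
    note w = sf_sup_in_sub_sigma_fields[OF u v]
    note int = CE_integrable[OF w fi] CE_integrable[OF u fi] CE_integrable[OF v fi]
      CE_integrable[OF v CE_integrable[OF u fi]] CE_integrable[OF v yi] CE_integrable[OF z(2) yi]
    have "dist1 f h \<le> dist1 f (CE (sf_sup M u v) f) + dist1 (CE (sf_sup M u v) f) h"
      using fi int hi by (intro dist1_triangle)
    also have "dist1 f (CE (sf_sup M u v) f) = dist1 (CE (sf_sup M u v) f) f" by (rule dist1_commute)
    also have "dist1 (CE (sf_sup M u v) f) h
        \<le> expectation (\<lambda>\<omega>. \<bar>CE u f \<omega> - CE y f \<omega>\<bar> + \<bar>CE v f \<omega> - CE z f \<omega>\<bar> + \<bar>CE v (CE u f) \<omega> - CE z (CE y f) \<omega>\<bar>)"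
      unfolding dist1_def
    proof (rule integral_mono_AE)
      show "AE \<omega> in M. \<bar>CE (sf_sup M u v) f \<omega> - h \<omega>\<bar>
          \<le> \<bar>CE u f \<omega> - CE y f \<omega>\<bar> + \<bar>CE v f \<omega> - CE z f \<omega>\<bar> + \<bar>CE v (CE u f) \<omega> - CE z (CE y f) \<omega>\<bar>"
        using first_chaos_sf_sup[OF B f uB vB] zy0 unfolding h_def by eventually_elim linarith
    qed (use int hi yi zi in auto)
    also have "\<dots> = dist1 (CE u f) (CE y f) + dist1 (CE v f) (CE z f) + dist1 (CE v (CE u f)) (CE z (CE y f))"
      unfolding dist1_def using int yi zi by simp
    also have "dist1 (CE v (CE u f)) (CE z (CE y f))
        \<le> dist1 (CE v (CE u f)) (CE v (CE y f)) + dist1 (CE v (CE y f)) (CE z (CE y f))"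
      using int by (intro dist1_triangle)
    also have "dist1 (CE v (CE u f)) (CE v (CE y f)) \<le> dist1 (CE u f) (CE y f)"
      by (rule CE_contraction[OF v int(2) yi])
    finally show ?case unfolding e_def u_def v_def by simp
  qed
  ultimately have "dist1 f h \<le> 0"
    using F1(1) F2(1) by (intro tendsto_lowerbound[of e 0 ?F]) (auto simp: prod_filter_eq_bot)
  then have "dist1 f h = 0" using dist1_nonneg[of f h] by simp
  then show ?thesis using dist1_eq_0_iff[OF fi hi] unfolding h_def by simp
qed

lemma first_chaos_antimono_sf_closure:
  assumes B1: "noise_type_boolean_algebra M B1" and B2: "noise_type_boolean_algebra M B2"
    and sub: "sf_closure M B2 \<subseteq> sf_closure M B1"
  shows "first_chaos M B1 \<subseteq> first_chaos M B2"
proof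
  fix f assume f: "f \<in> first_chaos M B1"
  have BL: "B2 \<subseteq> sub_sigma_fields M" using B2 by (simp add: noise_type_boolean_algebra_def)
  have "AE \<omega> in M. f \<omega> = CE x f \<omega> + CE (complement_in M B2 x) f \<omega>" if x: "x \<in> B2" for x
  proof -
    define x' where "x' = complement_in M B2 x"
    have x': "x' \<in> B2" "is_complement M x x'" using complement_in[OF B2 x] by (auto simp: x'_def)
    have "indep_set x x'" using B2 x by (simp add: noise_type_boolean_algebra_def x'_def)
    moreover have "sf_sup M x' x = sets M" using x'(2) by (simp add: is_complement_def sf_sup_commute)
    ultimately have "AE \<omega> in M. f \<omega> = CE x' f \<omega> + CE x f \<omega>"
      using x x'(1) BL subset_sf_closure[OF BL] sub
      by (intro first_chaos_split_closure[OF B1 f]) auto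
    then show ?thesis unfolding x'_def by (simp add: add.commute)
  qed
  then show "f \<in> first_chaos M B2" using f by (simp add: first_chaos_def)
qed

end

theorem proposition1p10:
  fixes M :: "'a measure" and B1 B2 :: "'a set set set"
  assumes "prob_space M"
    and "separable_L2 M"
    and "noise_type_boolean_algebra M B1"
    and "noise_type_boolean_algebra M B2"
    and "sf_closure M B1 = sf_closure M B2"
  shows "first_chaos M B1 = first_chaos M B2"
proof -
  interpret prob_space M by fact
  show ?thesis
    using assms(3-5) first_chaos_antimono_sf_closure[of B1 B2] first_chaos_antimono_sf_closure[of B2 B1] by blast
qed

end
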